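(* Let $m_0,m_1\in\mathbb R^n$, let $\Sigma_0,\Sigma_1$ be symmetric positive definite $n\times n$ matrices, and let $\rho_1=\mathcal N(m_1,\Sigma_1)$. Let $\lambda:[0,1)\to[0,\infty)$ be continuous, and let $H(\Sigma)$, $K(t,\Sigma)=\lambda(t)H(\Sigma)$ be as in the context. Then the covariance equation $$\dot\Sigma(t)=K(t,\Sigma(t))\Sigma(t)+\Sigma(t)K(t,\Sigma(t))^\top,\qquad \Sigma(0)=\Sigma_0,$$ admits a unique solution satisfying $\Sigma(t)\succ0$ on $[0,1)$. Define, for $t\in[0,1)$, $$m(t):=m_1+\exp\Bigl(-\frac1n\int_0^t\lambda(s)\,\mathrm ds\Bigr)(m_0-m_1),$$ $$\eta(t):=-\lambda(t)\Bigl[\bigl(H(\Sigma(t))+\tfrac1nI\bigr)m(t)-\tfrac1n m_1\Bigr].$$ With initial law $X(0)\sim\mathcal N(m_0,\Sigma_0)$, the affine system $\dot X(t)=K(t,\Sigma(t))X(t)+\eta(t)$ admits a unique solution on $[0,1)$ and it satisfies $X(t)\sim\mathcal N(m(t),\Sigma(t))$ for all $t\in[0,1)$. Moreover, if $g_t$ is the sliced discrepancy field computed from $\rho_t=\mathcal N(m(t),\Sigma(t))$ and the target $\rho_1$, then $$-\lambda(t)g_t(x)=K(t,\Sigma(t))x+\eta(t)$$ for all $t\in[0,1)$ and $x\in\mathbb R^n$. Hence the averaged sliced feedback $-\lambda(t)g_t(x)$ is affine in $x$ and preserves Gaussianity.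
   Context: $\mathcal S^{n-1}$ is the unit sphere of $\mathbb R^n$ and $\sigma$ its uniform probability measure. For $\Sigma\succ0$ and $\theta\in\mathcal S^{n-1}$, $\alpha(\Sigma,\theta):=\sqrt{\theta^\top\Sigma_1\theta/\theta^\top\Sigma\theta}$, and $$H(\Sigma):=\int_{\mathcal S^{n-1}}\alpha(\Sigma,\theta)\,\theta\theta^\top\,\sigma(\mathrm d\theta)-\frac1nI,\qquad K(t,\Sigma):=\lambda(t)H(\Sigma).$$ For a law $\rho_t$ with a density, let $\rho_{t,\theta}$ and $\rho_{1,\theta}$ be the pushforwards of $\rho_t$ and $\rho_1$ under $x\mapsto\theta^\top x$, and let $\mathcal T_t^\theta$ be the one-dimensional monotone optimal transport map from $\rho_{t,\theta}$ to $\rho_{1,\theta}$. The sliced discrepancy field is $$g_t(x)=\int_{\mathcal S^{n-1}}\bigl(\theta^\top x-\mathcal T_t^\theta(\theta^\top x)\bigr)\theta\,\sigma(\mathrm d\theta).$$ *)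

theory Defs
  imports "HOL-Probability.Probability"
begin

text \<open>
  The uniform probability measure on the unit sphere is the image of the normalized volume of the
  unit ball under the radial projection \<^term>\<open>sgn\<close>, i.e. \<open>x \<mapsto> x / \<parallel>x\<parallel>\<close>
  (the value \<open>sgn 0 = 0\<close> concerns a null set only).
\<close>

definition sphere_measure :: "(real ^ 'n) measure" where
  "sphere_measure =
     restrict_space (distr (uniform_measure lborel (ball 0 1)) borel sgn) (sphere 0 1)"

definition pos_def :: "real ^ 'n ^ 'n \<Rightarrow> bool" where
  "pos_def A \<longleftrightarrow> transpose A = A \<and> (\<forall>x. x \<noteq> 0 \<longrightarrow> x \<bullet> (A *v x) > 0)"

definition outer_square :: "real ^ 'n \<Rightarrow> real ^ 'n ^ 'n" where
  "outer_square v = (\<chi> i j. v $ i * v $ j)"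

definition alpha :: "real ^ 'n ^ 'n \<Rightarrow> real ^ 'n ^ 'n \<Rightarrow> real ^ 'n \<Rightarrow> real" where
  "alpha \<Sigma>1 \<Sigma> \<theta> = sqrt ((\<theta> \<bullet> (\<Sigma>1 *v \<theta>)) / (\<theta> \<bullet> (\<Sigma> *v \<theta>)))"

definition H_mat :: "real ^ 'n ^ 'n \<Rightarrow> real ^ 'n ^ 'n \<Rightarrow> real ^ 'n ^ 'n" where
  "H_mat \<Sigma>1 \<Sigma> =
     (\<integral>\<theta>. alpha \<Sigma>1 \<Sigma> \<theta> *\<^sub>R outer_square \<theta> \<partial>sphere_measure) - (1 / real CARD('n)) *\<^sub>R mat 1"

definition K_mat ::
    "(real \<Rightarrow> real) \<Rightarrow> real ^ 'n ^ 'n \<Rightarrow> real \<Rightarrow> real ^ 'n ^ 'n \<Rightarrow> real ^ 'n ^ 'n" where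
  "K_mat lam \<Sigma>1 t \<Sigma> = lam t *\<^sub>R H_mat \<Sigma>1 \<Sigma>"

definition mv_normal_density :: "real ^ 'n \<Rightarrow> real ^ 'n ^ 'n \<Rightarrow> real ^ 'n \<Rightarrow> real" where
  "mv_normal_density \<mu> \<Sigma> x =
     exp (- ((x - \<mu>) \<bullet> (matrix_inv \<Sigma> *v (x - \<mu>))) / 2) / sqrt ((2 * pi) ^ CARD('n) * det \<Sigma>)"

definition mv_normal :: "real ^ 'n \<Rightarrow> real ^ 'n ^ 'n \<Rightarrow> (real ^ 'n) measure" where
  "mv_normal \<mu> \<Sigma> = density lborel (\<lambda>x. ennreal (mv_normal_density \<mu> \<Sigma> x))"

definition projected_law :: "real ^ 'n \<Rightarrow> (real ^ 'n) measure \<Rightarrow> real measure" where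
  "projected_law \<theta> \<rho> = distr \<rho> borel (\<lambda>x. \<theta> \<bullet> x)"

definition transports :: "real measure \<Rightarrow> real measure \<Rightarrow> (real \<Rightarrow> real) \<Rightarrow> bool" where
  "transports \<mu> \<nu> T \<longleftrightarrow> T \<in> borel_measurable \<mu> \<and> distr \<mu> borel T = \<nu>"

definition is_monotone_ot_map :: "real measure \<Rightarrow> real measure \<Rightarrow> (real \<Rightarrow> real) \<Rightarrow> bool" where
  "is_monotone_ot_map \<mu> \<nu> T \<longleftrightarrow>
     mono T \<and> transports \<mu> \<nu> T \<and>
     (\<forall>S. transports \<mu> \<nu> S \<longrightarrow>
        (\<integral>\<^sup>+ x. ennreal ((x - T x)\<^sup>2) \<partial>\<mu>) \<le> (\<integral>\<^sup>+ x. ennreal ((x - S x)\<^sup>2) \<partial>\<mu>))"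

text \<open>
  In general the monotone optimal map is unique only almost everywhere, hence the choice operator.
  Between nondegenerate Gaussians on the line it is unique as a function: both laws are atomless
  with full support, which forces \<open>T\<close> to be the quantile function of \<open>\<nu>\<close> composed with the
  distribution function of \<open>\<mu>\<close> at every point.
\<close>

definition monotone_ot_map :: "real measure \<Rightarrow> real measure \<Rightarrow> real \<Rightarrow> real" where
  "monotone_ot_map \<mu> \<nu> = (SOME T. is_monotone_ot_map \<mu> \<nu> T)"

definition slice_displacement ::
    "(real ^ 'n) measure \<Rightarrow> (real ^ 'n) measure \<Rightarrow> real ^ 'n \<Rightarrow> real ^ 'n \<Rightarrow> real ^ 'n" where
  "slice_displacement \<rho> \<rho>1 x \<theta> =
     (\<theta> \<bullet> x - monotone_ot_map (projected_law \<theta> \<rho>) (projected_law \<theta> \<rho>1) (\<theta> \<bullet> x)) *\<^sub>R \<theta>"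

definition sliced_field ::
    "(real ^ 'n) measure \<Rightarrow> (real ^ 'n) measure \<Rightarrow> real ^ 'n \<Rightarrow> real ^ 'n" where
  "sliced_field \<rho> \<rho>1 x = (\<integral>\<theta>. slice_displacement \<rho> \<rho>1 x \<theta> \<partial>sphere_measure)"

text \<open>Classical solutions on the half-open interval; the derivative at \<open>0\<close> is one-sided.\<close>

definition solves_ivp ::
    "(real \<Rightarrow> 'a \<Rightarrow> 'a) \<Rightarrow> 'a \<Rightarrow> (real \<Rightarrow> 'a::real_normed_vector) \<Rightarrow> bool" where
  "solves_ivp f x0 x \<longleftrightarrow>
     x 0 = x0 \<and> (\<forall>t\<in>{0..<1}. (x has_vector_derivative f t (x t)) (at t within {0..<1}))"

definition solves_covariance ::
    "(real \<Rightarrow> real) \<Rightarrow> real ^ 'n ^ 'n \<Rightarrow> real ^ 'n ^ 'n \<Rightarrow> (real \<Rightarrow> real ^ 'n ^ 'n) \<Rightarrow> bool" where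
  "solves_covariance lam \<Sigma>1 \<Sigma>0 \<Sigma> \<longleftrightarrow>
     solves_ivp (\<lambda>t S. K_mat lam \<Sigma>1 t S ** S + S ** transpose (K_mat lam \<Sigma>1 t S)) \<Sigma>0 \<Sigma> \<and>
     (\<forall>t\<in>{0..<1}. pos_def (\<Sigma> t))"

definition mean_path ::
    "(real \<Rightarrow> real) \<Rightarrow> real ^ 'n \<Rightarrow> real ^ 'n \<Rightarrow> real \<Rightarrow> real ^ 'n" where
  "mean_path lam m1 m0 t =
     m1 + exp (- (1 / real CARD('n)) * integral {0..t} lam) *\<^sub>R (m0 - m1)"

definition eta ::
    "(real \<Rightarrow> real) \<Rightarrow> real ^ 'n \<Rightarrow> real ^ 'n \<Rightarrow> real ^ 'n ^ 'n \<Rightarrow> (real \<Rightarrow> real ^ 'n ^ 'n) \<Rightarrow>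
       real \<Rightarrow> real ^ 'n" where
  "eta lam m1 m0 \<Sigma>1 \<Sigma> t =
     - (lam t *\<^sub>R ((H_mat \<Sigma>1 (\<Sigma> t) + (1 / real CARD('n)) *\<^sub>R mat 1) *v mean_path lam m1 m0 t
                  - (1 / real CARD('n)) *\<^sub>R m1))"

text \<open>A random solution is one all of whose trajectories solve the equation.\<close>

definition solves_random_ivp ::
    "'w measure \<Rightarrow> (real \<Rightarrow> 'a \<Rightarrow> 'a) \<Rightarrow> ('w \<Rightarrow> 'a) \<Rightarrow> (real \<Rightarrow> 'w \<Rightarrow> 'a::real_normed_vector) \<Rightarrow> bool"
  where
  "solves_random_ivp M f X0 X \<longleftrightarrow> (\<forall>\<omega>\<in>space M. solves_ivp f (X0 \<omega>) (\<lambda>t. X t \<omega>))"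

lemma space_sphere_measure: "space sphere_measure = sphere 0 1"
  by (simp add: sphere_measure_def space_restrict_space)

lemma prob_space_sphere_measure: "prob_space (sphere_measure :: (real ^ 'n) measure)"
proof -
  let ?U = "uniform_measure lborel (ball 0 1 :: (real ^ 'n) set)"
  let ?D = "distr ?U borel sgn"
  have sgn_meas: "(sgn :: real ^ 'n \<Rightarrow> real ^ 'n) \<in> borel_measurable borel"
    by measurable
  have fin: "emeasure lborel (ball 0 1 :: (real ^ 'n) set) \<noteq> \<infinity>"
    using emeasure_lborel_ball_finite[of "0 :: real ^ 'n" 1] by auto
  have nz: "emeasure lborel (ball 0 1 :: (real ^ 'n) set) \<noteq> 0"
    using content_ball_pos[of 1 "0 :: real ^ 'n"] by (auto simp: measure_def)
  interpret U: prob_space ?U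
    by (rule prob_space_uniform_measure) (use fin nz in auto)
  interpret D: prob_space ?D
    by (rule U.prob_space_distr) (use sgn_meas in simp)
  have "AE x in lborel. x \<noteq> (0 :: real ^ 'n)"
    by (rule AE_lborel_singleton)
  then have "AE x in ?U. x \<noteq> 0"
    by (intro AE_uniform_measureI) auto
  then have "AE x in ?U. sgn x \<in> sphere 0 1"
    by eventually_elim (simp add: norm_sgn)
  then have "AE y in ?D. y \<in> sphere 0 1"
    by (subst AE_distr_iff) (use sgn_meas in auto)
  then have "emeasure ?D (sphere 0 1) = 1"
    using D.emeasure_eq_1_AE[of "sphere 0 1"] by simp
  then show ?thesis
    unfolding sphere_measure_def
    by (intro prob_spaceI) (simp add: space_restrict_space emeasure_restrict_space)
qed

end

theory Submission
  imports Defs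
begin

text \<open>
  The right-hand side of the covariance equation is singular at degenerate matrices and only
  locally Lipschitz, so it is first replaced by a globally Lipschitz one: the denominator of
  \<^term>\<open>alpha\<close> is cut off at some \<open>\<epsilon>\<close> and \<open>\<Sigma>\<close> is projected onto a ball. On \<open>[0, T]\<close> with
  \<open>T < 1\<close>, Gronwall's inequality bounds \<open>\<Sigma>\<close> from above, and
  \<open>H \<ge> - I / n\<close> bounds it from below by \<open>exp (- 2 / n * \<integral>\<^sub>0\<^sup>T \<lambda>)\<close> times the least eigenvalue of
  \<open>\<Sigma>0\<close>, whatever the cutoff; for suitable constants the modification is therefore invisible.
  With the fundamental matrix \<open>\<Phi>\<close> of \<open>\<Phi>' = K \<Phi>\<close> one has \<open>\<Sigma> = \<Phi> \<Sigma>0 \<Phi>\<^sup>T\<close> and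
  \<open>X = m + \<Phi> (X0 - m0)\<close>, an affine image of a Gaussian vector. The projections of
  Gaussian laws are Gaussian, the monotone transport between them is affine, and integrating it
  over the sphere with \<open>\<integral> \<theta> \<theta>\<^sup>T d\<sigma> = I / n\<close> gives the drift.
\<close>

section \<open>Ordinary differential equations on a half-open interval\<close>

text \<open>The order in which the constants are fixed avoids a circle. The cutoff depends only on
  \<open>T\<close>, \<open>\<Sigma>0\<close> and \<open>lam\<close>, because positivity of the
  integral in \<open>H\<close> survives any cutoff; the radius of the ball comes after it, from a
  growth bound that does not see the radius. The bound on the norm removes the projection first, and
  only then does the lower bound remove the cutoff. Nothing controls \<open>lam\<close> near 1,
  where its integral may diverge and the constants degenerate, so solutions are built on each
  \<open>{0..T}\<close> and glued by uniqueness. The transport map is obtained through a choice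
  operator, so optimality of the affine map is not enough: every monotone transport has to equal it
  at every point.\<close>

lemma continuous_on_Ico_Icc:
  fixes t :: real
  assumes "continuous_on {0..<1} f" "t < 1"
  shows "continuous_on {0..t} f"
  by (rule continuous_on_subset[OF assms(1)]) (use assms(2) in auto)

text \<open>Near a point \<open>t < T\<close> the two sets coincide, so limits at \<open>t\<close>
  do too. The lemmas below work on \<open>{0..T}\<close> with \<open>T\<close> the midpoint of
  \<open>t\<close> and 1.\<close>

lemma at_within_Icc_eq_Ico:
  fixes t T :: real
  assumes "t < T" "T < 1"
  shows "at t within {0..T} = at t within {0..<1}"
  by (rule at_within_nhd[of _ "{..<T}"]) (use assms in auto)

lemma continuous_on_Ico_if_Icc:
  fixes f :: "real \<Rightarrow> 'a::topological_space"
  assumes "\<And>T. 0 \<le> T \<Longrightarrow> T < 1 \<Longrightarrow> continuous_on {0..T} f"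
  shows "continuous_on {0..<1} f"
  unfolding continuous_on_eq_continuous_within
proof
  fix t :: real assume t: "t \<in> {0..<1}"
  have "continuous (at t within {0..(t+1)/2}) f"
    using assms[of "(t+1)/2"] t by (auto simp: continuous_on_eq_continuous_within)
  then show "continuous (at t within {0..<1}) f"
    using at_within_Icc_eq_Ico[of t "(t+1)/2"] t by simp
qed

lemma has_vector_derivative_integral_Ico:
  fixes f :: "real \<Rightarrow> 'a::euclidean_space"
  assumes "continuous_on {0..<1} f" "t \<in> {0..<1}"
  shows "((\<lambda>t. integral {0..t} f) has_vector_derivative f t) (at t within {0..<1})"
proof -
  define T where "T = (t + 1) / 2"
  have T: "t < T" "T < 1" "0 \<le> t" using assms(2) by (auto simp: T_def)
  have "((\<lambda>t. integral {0..t} f) has_vector_derivative f t) (at t within {0..T})"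
    by (rule integral_has_vector_derivative)
      (use T in \<open>auto intro!: continuous_on_subset[OF assms(1)]\<close>)
  then show ?thesis using at_within_Icc_eq_Ico T by simp
qed

lemma continuous_on_integral_Ico:
  fixes f :: "real \<Rightarrow> 'a::euclidean_space"
  assumes "continuous_on {0..<1} f"
  shows "continuous_on {0..<1} (\<lambda>t. integral {0..t} f)"
  unfolding continuous_on_eq_continuous_within
  by (blast intro: has_vector_derivative_continuous has_vector_derivative_integral_Ico[OF assms])

section \<open>Gronwall's inequality and uniqueness\<close>

text \<open>The function \<open>w\<close>, the squared norm damped by the exponential, has
  nonpositive derivative; squaring avoids the kink of the norm at 0. Bounding
  \<open>x t \<bullet> x' t\<close> from one side, instead of the norm of \<open>x' t\<close>,
  allows a lower bound on a matrix to serve as a growth bound for the adjoint system.\<close>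

lemma gronwall_norm:
  fixes x x' :: "real \<Rightarrow> 'a::real_inner" and l :: "real \<Rightarrow> real"
  assumes x': "\<And>t. t \<in> {0..T} \<Longrightarrow> (x has_vector_derivative x' t) (at t within {0..T})"
    and l: "continuous_on {0..T} l"
    and le: "\<And>t. t \<in> {0..T} \<Longrightarrow> x t \<bullet> x' t \<le> l t * (norm (x t))\<^sup>2"
    and t: "t \<in> {0..T}"
  shows "norm (x t) \<le> norm (x 0) * exp (integral {0..t} l)"
proof (cases "t = 0")
  case False
  then have t0: "0 < t" "t \<le> T" using t by auto
  define w where "w s = (x s \<bullet> x s) * exp (- 2 * integral {0..s} l)" for s
  define w' where
    "w' s = (2 * (x s \<bullet> x' s) - 2 * l s * (x s \<bullet> x s)) * exp (- 2 * integral {0..s} l)" for s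
  have "(w has_derivative (\<lambda>h. h * w' s)) (at s within {0..t})" if s: "s \<in> {0..t}" for s
  proof -
    have a: "(x has_derivative (\<lambda>h. h *\<^sub>R x' s)) (at s within {0..t})"
      using has_vector_derivative_within_subset[OF x'[of s], of "{0..t}"] s t0
      unfolding has_vector_derivative_def by auto
    have b: "((\<lambda>s. integral {0..s} l) has_derivative (\<lambda>h. h * l s)) (at s within {0..t})"
      using integral_has_vector_derivative[OF continuous_on_subset[OF l, of "{0..t}"], of s] s t0
      unfolding has_vector_derivative_def by auto
    show ?thesis unfolding w_def
      by (rule derivative_eq_intros a b refl)+
        (auto simp: w'_def algebra_simps inner_commute)
  qed
  from mvt_simple[OF t0(1), of w "\<lambda>s h. h * w' s"] this
  obtain s where s: "s \<in> {0<..<t}" "w t - w 0 = (t - 0) * w' s" by auto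
  have "w' s \<le> 0"
    unfolding w'_def using le[of s] s t0
    by (intro mult_nonpos_nonneg) (auto simp: power2_norm_eq_inner)
  then have "w t \<le> w 0" using s t0 by (smt (verit) mult_nonneg_nonpos)
  then have "(norm (x t))\<^sup>2 \<le> (norm (x 0))\<^sup>2 * (exp (integral {0..t} l))\<^sup>2"
    by (simp add: w_def power2_norm_eq_inner exp_minus field_simps exp_double)
  then have "(norm (x t))\<^sup>2 \<le> (norm (x 0) * exp (integral {0..t} l))\<^sup>2"
    by (simp add: power_mult_distrib)
  then show ?thesis by (rule power2_le_imp_le) simp
qed simp

text \<open>Gronwall's inequality for \<open>x - y\<close>, which vanishes at 0. The Lipschitz
  estimate is asked for only along the two trajectories.\<close>

lemma ode_unique_Icc:
  fixes x y :: "real \<Rightarrow> 'a::real_inner" and l :: "real \<Rightarrow> real"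
  assumes x: "\<And>t. t \<in> {0..T} \<Longrightarrow> (x has_vector_derivative f t (x t)) (at t within {0..T})"
    and y: "\<And>t. t \<in> {0..T} \<Longrightarrow> (y has_vector_derivative f t (y t)) (at t within {0..T})"
    and l: "continuous_on {0..T} l"
    and lip: "\<And>t. t \<in> {0..T} \<Longrightarrow> norm (f t (x t) - f t (y t)) \<le> l t * norm (x t - y t)"
    and t: "t \<in> {0..T}" and init: "x 0 = y 0"
  shows "x t = y t"
proof -
  have "norm (x t - y t) \<le> norm (x 0 - y 0) * exp (integral {0..t} l)"
  proof (rule gronwall_norm[OF _ l _ t])
    fix s assume s: "s \<in> {0..T}"
    show "((\<lambda>t. x t - y t) has_vector_derivative f s (x s) - f s (y s)) (at s within {0..T})"
      by (intro has_vector_derivative_diff x y s)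
    have "(x s - y s) \<bullet> (f s (x s) - f s (y s)) \<le> norm (x s - y s) * norm (f s (x s) - f s (y s))"
      by (rule norm_cauchy_schwarz)
    also have "\<dots> \<le> norm (x s - y s) * (l s * norm (x s - y s))"
      by (intro mult_left_mono lip s) simp
    finally show "(x s - y s) \<bullet> (f s (x s) - f s (y s)) \<le> l s * (norm (x s - y s))\<^sup>2"
      by (simp add: power2_eq_square mult_ac)
  qed
  then show ?thesis using init by simp
qed

lemma solves_ivp_Icc:
  assumes "solves_ivp f x0 x" "T < 1" "t \<in> {0..T}"
  shows "(x has_vector_derivative f t (x t)) (at t within {0..T})"
  by (rule has_vector_derivative_within_subset[of _ _ _ "{0..<1}"])
    (use assms in \<open>auto simp: solves_ivp_def\<close>)

lemma solves_ivp_continuous_on: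
  assumes "solves_ivp f x0 x"
  shows "continuous_on {0..<1} x"
  using assms unfolding solves_ivp_def continuous_on_eq_continuous_within
  by (auto intro: has_vector_derivative_continuous)

lemma solves_ivp_unique:
  fixes x y :: "real \<Rightarrow> 'a::real_inner" and l :: "real \<Rightarrow> real"
  assumes x: "solves_ivp f x0 x" and y: "solves_ivp f x0 y"
    and l: "continuous_on {0..<1} l"
    and lip: "\<And>t u v. t \<in> {0..<1} \<Longrightarrow> norm (f t u - f t v) \<le> l t * norm (u - v)"
    and t: "t \<in> {0..<1}"
  shows "x t = y t"
proof (rule ode_unique_Icc[of t x f y l])
  show "continuous_on {0..t} l" using l t by (auto intro: continuous_on_Ico_Icc)
  show "x 0 = y 0" using x y by (simp add: solves_ivp_def)
qed (use x y t in \<open>auto intro!: solves_ivp_Icc lip\<close>)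

text \<open>Picard iteration; the successive differences on \<open>[0, T]\<close> decay like
  \<open>2\<^sup>-\<^sup>k exp (2 L t)\<close> with \<open>L t\<close> the integral of the Lipschitz constant.\<close>

lemma picard_exists:
  fixes f :: "real \<Rightarrow> 'a::euclidean_space \<Rightarrow> 'a" and l :: "real \<Rightarrow> real"
  assumes cont: "\<And>x. continuous_on {0..<1} x \<Longrightarrow> continuous_on {0..<1} (\<lambda>t. f t (x t))"
    and l: "continuous_on {0..<1} l"
    and lip: "\<And>t u v. t \<in> {0..<1} \<Longrightarrow> norm (f t u - f t v) \<le> l t * norm (u - v)"
  shows "\<exists>x. solves_ivp f x0 x"
proof -
  define P where "P = rec_nat (\<lambda>_::real. x0) (\<lambda>_ x t. x0 + integral {0..t} (\<lambda>s. f s (x s)))"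
  have P0: "P 0 = (\<lambda>_. x0)"
    and PS: "P (Suc k) = (\<lambda>t. x0 + integral {0..t} (\<lambda>s. f s (P k s)))" for k
    by (simp_all add: P_def)
  have Pc: "continuous_on {0..<1} (P k)" for k
  proof (induction k)
    case (Suc k)
    have "continuous_on {0..<1} (\<lambda>t. integral {0..t} (\<lambda>s. f s (P k s)))"
      by (rule continuous_on_integral_Ico[OF cont[OF Suc]])
    then show ?case unfolding PS by (intro continuous_intros)
  qed (simp add: P0)
  have fint: "(\<lambda>s. f s (x s)) integrable_on {0..t}"
    if "continuous_on {0..<1} x" "t < 1" for x t
    by (rule integrable_continuous_interval)
      (use that cont in \<open>auto intro: continuous_on_Ico_Icc\<close>)
  define L where "L t = integral {0..t} l" for t
  have l_nonneg: "0 \<le> l t" if "t \<in> {0..<1}" for t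
  proof -
    \<comment> \<open>Two points at distance 1 in the Lipschitz estimate force \<open>l t\<close> to
      be nonnegative.\<close>
    obtain b :: 'a where b: "b \<in> Basis" using nonempty_Basis by blast
    have "norm (f t b - f t 0) \<le> l t" using lip[OF that, of b 0] b by (simp add: norm_Basis)
    then show ?thesis by (rule order_trans[OF norm_ge_zero])
  qed
  have L: "(L has_vector_derivative l t) (at t within {0..<1})" if "t \<in> {0..<1}" for t
    unfolding L_def using has_vector_derivative_integral_Ico[OF l that] .
  \<comment> \<open>Integrating \<open>l\<close> against the weight \<open>exp (2 * L)\<close>
    returns at most half the weight; this is the factor 1/2 gained in each Picard step.\<close>
  have expL: "((\<lambda>s. l s * exp (2 * L s)) has_integral (exp (2 * L t) - 1) / 2) {0..t}"
    if t: "t \<in> {0..<1}" for t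
  proof -
    have "((\<lambda>s. l s * exp (2 * L s)) has_integral exp (2 * L t) / 2 - exp (2 * L 0) / 2) {0..t}"
    proof (rule fundamental_theorem_of_calculus)
      fix s assume s: "s \<in> {0..t}"
      have "(L has_field_derivative l s) (at s within {0..t})"
        unfolding has_real_derivative_iff_has_vector_derivative
        by (rule has_vector_derivative_within_subset[OF L]) (use s t in auto)
      then have "((\<lambda>t. exp (2 * L t) / 2) has_field_derivative l s * exp (2 * L s)) (at s within {0..t})"
        by (auto intro!: derivative_eq_intros)
      then show "((\<lambda>t. exp (2 * L t) / 2) has_vector_derivative l s * exp (2 * L s)) (at s within {0..t})"
        by (simp add: has_real_derivative_iff_has_vector_derivative)
    qed (use t in auto)
    then show ?thesis by (simp add: L_def diff_divide_distrib)
  qed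
  have diff: "\<exists>M. \<forall>k. \<forall>t\<in>{0..T}. norm (P (Suc k) t - P k t) \<le> M * (1/2)^k" if T: "0 \<le> T" "T < 1" for T
  proof -
    have cT: "continuous_on {0..T} x" if "continuous_on {0..<1} x" for x :: "real \<Rightarrow> 'b::topological_space"
      using that T by (auto intro: continuous_on_Ico_Icc)
    have "compact ((P 1) ` {0..T})" using Pc T by (intro compact_continuous_image cT) auto
    then obtain M where M: "\<And>t. t \<in> {0..T} \<Longrightarrow> norm (P 1 t) \<le> M"
      by (meson bounded_iff compact_imp_bounded image_eqI)
    define M' where "M' = M + norm x0"
    have M'0: "M' \<ge> 0" using M[of 0] T norm_ge_zero[of "P 1 0"] norm_ge_zero[of x0]
      unfolding M'_def by (smt (verit) atLeastAtMost_iff)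
    have L0: "L t \<ge> 0" if "t \<in> {0..<1}" for t
      unfolding L_def using that l
      by (intro integral_nonneg integrable_continuous_interval l_nonneg)
        (auto intro: continuous_on_Ico_Icc)
    have *: "norm (P (Suc k) t - P k t) \<le> M' * (1/2)^k * exp (2 * L t)" if "t \<in> {0..T}" for k t
      using that
    proof (induction k arbitrary: t)
      case 0
      have "norm (P (Suc 0) t - P 0 t) \<le> norm (P 1 t) + norm x0"
        using norm_triangle_ineq4[of "P 1 t" x0] by (simp add: P0)
      also have "\<dots> \<le> M'" using M[OF 0] by (simp add: M'_def)
      also have "\<dots> \<le> M' * exp (2 * L t)"
        using M'0 L0[of t] 0 T by (simp add: mult_le_cancel_left1)
      finally show ?case by simp
    next
      case (Suc k)
      then have t: "t \<in> {0..<1}" using T by auto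
      have "norm (P (Suc (Suc k)) t - P (Suc k) t)
          = norm (integral {0..t} (\<lambda>s. f s (P (Suc k) s) - f s (P k s)))"
        using t by (subst integral_diff)
          (auto intro!: fint Pc
            simp: PS[of "Suc k", THEN fun_cong, of t] PS[of k, THEN fun_cong, of t])
      also have "\<dots> \<le> integral {0..t} (\<lambda>s. M' * (1/2)^k * (l s * exp (2 * L s)))"
      proof (rule integral_norm_bound_integral)
        show "(\<lambda>s. f s (P (Suc k) s) - f s (P k s)) integrable_on {0..t}"
          using t by (intro integrable_diff fint Pc) auto
        show "(\<lambda>s. M' * (1/2)^k * (l s * exp (2 * L s))) integrable_on {0..t}"
          by (rule has_integral_integrable[OF has_integral_mult_right[OF expL[OF t]]])
        fix s assume s: "s \<in> {0..t}"
        have "norm (f s (P (Suc k) s) - f s (P k s)) \<le> l s * norm (P (Suc k) s - P k s)"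
          using s t by (intro lip) auto
        also have "\<dots> \<le> l s * (M' * (1/2)^k * exp (2 * L s))"
          using s Suc t by (intro mult_left_mono l_nonneg Suc.IH) auto
        finally show "norm (f s (P (Suc k) s) - f s (P k s)) \<le> M' * (1/2)^k * (l s * exp (2 * L s))"
          by (simp add: mult_ac)
      qed
      also have "\<dots> = M' * (1/2)^k * ((exp (2 * L t) - 1) / 2)"
        by (rule integral_unique[OF has_integral_mult_right[OF expL[OF t]]])
      also have "\<dots> \<le> M' * (1/2)^k * (exp (2 * L t) / 2)"
        using M'0 by (intro mult_left_mono) auto
      finally show ?case by simp
    qed
    have "norm (P (Suc k) t - P k t) \<le> (M' * exp (2 * L T)) * (1/2)^k" if t: "t \<in> {0..T}" for k t
    proof -
      have "L t \<le> L T" unfolding L_def using t T l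
        by (intro integral_subset_le integrable_continuous_interval l_nonneg)
          (auto intro: continuous_on_Ico_Icc l_nonneg)
      then have "M' * (1/2)^k * exp (2 * L t) \<le> M' * (1/2)^k * exp (2 * L T)"
        using M'0 by (intro mult_left_mono) auto
      then show ?thesis using *[OF t, of k] by (simp add: mult_ac)
    qed
    then show ?thesis by blast
  qed
  \<comment> \<open>A pointwise limit does not depend on \<open>T\<close>, so one function serves
    all intervals; on each \<open>{0..T}\<close> it is then identified with the uniform
    limit.\<close>
  define x where "x t = lim (\<lambda>k. P k t)" for t
  have unif: "uniform_limit {0..T} P x sequentially" if T: "0 \<le> T" "T < 1" for T
  proof -
    obtain M where M: "\<And>k t. t \<in> {0..T} \<Longrightarrow> norm (P (Suc k) t - P k t) \<le> M * (1/2)^k"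
      using diff[OF T] by blast
    have "uniformly_convergent_on {0..T} (\<lambda>n t. \<Sum>k<n. P (Suc k) t - P k t)"
      by (rule Weierstrass_m_test'[OF M]) (auto intro!: summable_mult summable_geometric)
    then obtain g where "uniform_limit {0..T} (\<lambda>n t. \<Sum>k<n. P (Suc k) t - P k t) g sequentially"
      by (auto simp: uniformly_convergent_on_def)
    then have "uniform_limit {0..T} (\<lambda>n t. (\<Sum>k<n. P (Suc k) t - P k t) + x0) (\<lambda>t. g t + x0) sequentially"
      by (intro uniform_limit_add uniform_limit_const)
    moreover have "(\<lambda>n t. (\<Sum>k<n. P (Suc k) t - P k t) + x0) = P"
    proof (intro ext)
      show "(\<Sum>k<n. P (Suc k) t - P k t) + x0 = P n t" for n t
        using sum_lessThan_telescope[of "\<lambda>k. P k t" n] by (simp add: P0)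
    qed
    ultimately have u: "uniform_limit {0..T} P (\<lambda>t. g t + x0) sequentially"
      by simp
    have "x t = g t + x0" if "t \<in> {0..T}" for t
      unfolding x_def using tendsto_uniform_limitI[OF u that] by (rule limI)
    then show ?thesis using u by (subst uniform_limit_cong'[where g = P and i = "\<lambda>t. g t + x0"]) auto
  qed
  have xcT: "continuous_on {0..T} x" if "0 \<le> T" "T < 1" for T
    by (rule uniform_limit_theorem[OF _ unif[OF that]])
      (use Pc that in \<open>auto intro!: always_eventually intro: continuous_on_Ico_Icc\<close>)
  have xc: "continuous_on {0..<1} x" by (rule continuous_on_Ico_if_Icc[OF xcT])
  have x_eq: "x t = x0 + integral {0..t} (\<lambda>s. f s (x s))" if t: "t \<in> {0..<1}" for t
  proof -
    have t': "0 \<le> t" "t < 1" using t by auto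
    have ul: "uniform_limit {0..t} (\<lambda>k s. f s (P k s)) (\<lambda>s. f s (x s)) sequentially"
    proof -
      have "compact (l ` {0..t})"
        using l t by (intro compact_continuous_image) (auto intro: continuous_on_Ico_Icc)
      then obtain B where B: "\<And>s. s \<in> {0..t} \<Longrightarrow> norm (l s) \<le> B"
        by (meson bounded_iff compact_imp_bounded image_eqI)
      show ?thesis
      proof (rule uniform_limitI)
        fix e :: real assume e: "0 < e"
        have B0: "0 \<le> B" using B[of 0] t' by fastforce
        have "\<forall>\<^sub>F k in sequentially. \<forall>s\<in>{0..t}. dist (P k s) (x s) < e / (B + 1)"
          using unif[OF t'] e B0 by (intro uniform_limitD) auto
        then show "\<forall>\<^sub>F k in sequentially. \<forall>s\<in>{0..t}. dist (f s (P k s)) (f s (x s)) < e"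
        proof eventually_elim
          case (elim k)
          show ?case
          proof
            fix s assume s: "s \<in> {0..t}"
            have "dist (f s (P k s)) (f s (x s)) \<le> l s * dist (P k s) (x s)"
              using lip[of s] s t by (auto simp: dist_norm)
            also have "\<dots> \<le> B * dist (P k s) (x s)"
              using B[OF s] by (intro mult_right_mono) auto
            also have "\<dots> \<le> B * (e / (B + 1))"
              using elim s B0 by (intro mult_left_mono) (auto intro: less_imp_le)
            also have "\<dots> < e" using e B0 by (simp add: field_simps)
            finally show "dist (f s (P k s)) (f s (x s)) < e" .
          qed
        qed
      qed
    qed
    obtain I J where IJ: "\<And>k. ((\<lambda>s. f s (P k s)) has_integral I k) {0..t}"
      "((\<lambda>s. f s (x s)) has_integral J) {0..t}" "(I \<longlongrightarrow> J) sequentially"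
    proof (rule uniform_limit_integral[OF ul])
      show "continuous_on {0..t} (\<lambda>s. f s (P k s))" for k
        using cont[OF Pc] t by (auto intro: continuous_on_Ico_Icc)
    qed auto
    then have "(\<lambda>k. x0 + I k) \<longlonglongrightarrow> x0 + J" by (intro tendsto_intros)
    moreover have "x0 + I k = P (Suc k) t" for k
      using IJ(1)[of k] by (simp add: PS integral_unique)
    ultimately have "(\<lambda>k. P (Suc k) t) \<longlonglongrightarrow> x0 + J" by simp
    moreover have "(\<lambda>k. P (Suc k) t) \<longlonglongrightarrow> x t"
      using tendsto_uniform_limitI[OF unif[OF t'], of t] t'
      by (subst filterlim_sequentially_Suc) auto
    ultimately have "x t = x0 + J" by (rule LIMSEQ_unique[rotated])
    then show ?thesis using IJ(2) by (simp add: integral_unique)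
  qed
  have "solves_ivp f x0 x"
    unfolding solves_ivp_def
  proof (intro conjI ballI)
    show "x 0 = x0" using x_eq[of 0] by simp
    fix t :: real assume t: "t \<in> {0..<1}"
    have "((\<lambda>t. x0 + integral {0..t} (\<lambda>s. f s (x s))) has_vector_derivative f t (x t)) (at t within {0..<1})"
      using has_vector_derivative_add[OF has_vector_derivative_const
          has_vector_derivative_integral_Ico[OF cont[OF xc] t], of x0] by simp
    then show "(x has_vector_derivative f t (x t)) (at t within {0..<1})"
      by (rule has_vector_derivative_transform[OF t, rotated]) (simp add: x_eq)
  qed
  then show ?thesis by blast
qed

section \<open>Symmetric matrices\<close>

lemma inner_matrix_vector_mult: "(A *v x) \<bullet> y = x \<bullet> (transpose A *v y)"
  for A :: "real^'n^'m"
  by (metis dot_lmul_matrix inner_commute transpose_matrix_vector)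

lemma matrix_inv_right: "invertible A \<Longrightarrow> A ** matrix_inv A = mat 1"
  and matrix_inv_left: "invertible A \<Longrightarrow> matrix_inv A ** A = mat 1"
  for A :: "real^'n^'n"
  unfolding invertible_def matrix_inv_def by (metis (mono_tags, lifting) someI_ex)+

lemma matrix_inv_mult_vector:
  fixes A :: "real^'n^'n"
  assumes "invertible A"
  shows "matrix_inv A *v (A *v x) = x" "A *v (matrix_inv A *v x) = x"
  using assms by (simp_all add: matrix_vector_mul_assoc matrix_inv_left matrix_inv_right)

lemma pos_def_invertible:
  assumes "pos_def A"
  shows "invertible A"
proof -
  have "x = 0" if "A *v x = 0" for x
    using assms that unfolding pos_def_def by (metis inner_zero_right less_irrefl)
  then show ?thesis
    unfolding invertible_left_inverse matrix_left_invertible_ker by blast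
qed

section \<open>The spectral theorem for symmetric matrices\<close>

definition diag_mat :: "('n \<Rightarrow> real) \<Rightarrow> real^'n^'n" where
  "diag_mat d = (\<chi> i j. if i = j then d i else 0)"

lemma diag_mat_mult_vector: "diag_mat d *v x = (\<chi> i. d i * x $ i)"
  unfolding diag_mat_def matrix_vector_mult_def by (simp add: if_distrib if_distribR cong: if_cong)

lemma transpose_diag_mat [simp]: "transpose (diag_mat d) = diag_mat d"
  by (auto simp: transpose_def diag_mat_def vec_eq_iff)

lemma det_diag_mat: "det (diag_mat d) = (\<Prod>i\<in>UNIV. d i)"
  by (subst det_diagonal) (auto simp: diag_mat_def)

text \<open>A maximiser of the quadratic form on the unit sphere of the orthogonal complement of the
  eigenvectors found so far is a further eigenvector.\<close>

lemma orthonormal_eigenvectors: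
  fixes A :: "real^'n^'n"
  assumes sym: "transpose A = A" and k: "k \<le> CARD('n)"
  shows "\<exists>B. finite B \<and> card B = k \<and> pairwise orthogonal B \<and>
    (\<forall>b\<in>B. norm b = 1 \<and> (\<exists>d. A *v b = d *\<^sub>R b))"
  using k
proof (induction k)
  case 0
  show ?case by (rule exI[of _ "{}"]) auto
next
  case (Suc k)
  then obtain B where B: "finite B" "card B = k" "pairwise orthogonal B"
    "\<And>b. b \<in> B \<Longrightarrow> norm b = 1" "\<And>b. b \<in> B \<Longrightarrow> \<exists>d. A *v b = d *\<^sub>R b" by auto
  have symI: "(A *v x) \<bullet> y = x \<bullet> (A *v y)" for x y
    by (simp only: inner_matrix_vector_mult sym)
  define S where "S = {x :: real^'n. \<forall>b\<in>B. b \<bullet> x = 0}"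
  have S_eq: "S = (\<Inter>b\<in>B. {x. b \<bullet> x = 0})" by (auto simp: S_def)
  have clS: "closed S" unfolding S_eq by (intro closed_INT ballI closed_hyperplane)
  have S_add: "x + c *\<^sub>R y \<in> S" if "x \<in> S" "y \<in> S" for x y c
    using that by (auto simp: S_def inner_add_right)
  have S_A: "A *v x \<in> S" if "x \<in> S" for x
    unfolding S_def
  proof safe
    fix b assume b: "b \<in> B"
    then obtain d where "A *v b = d *\<^sub>R b" using B by blast
    then show "b \<bullet> (A *v x) = 0" using that b by (simp add: symI[symmetric] S_def)
  qed
  have "dim B < DIM(real^'n)"
    using dim_le_card'[OF B(1)] B(2) Suc.prems by simp
  from orthogonal_to_subspace_exists[OF this] obtain z where
    z: "z \<noteq> 0" "\<And>y. y \<in> span B \<Longrightarrow> orthogonal z y" by blast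
  have zS: "z \<in> S" using z(2) span_base by (auto simp: S_def orthogonal_def inner_commute)
  have "sgn z \<in> S \<inter> sphere 0 1"
    using S_add[of 0 z "inverse (norm z)"] zS z(1)
    by (auto simp: sgn_div_norm S_def norm_sgn divide_inverse_commute)
  then have "S \<inter> sphere 0 1 \<noteq> {}" by fast
  moreover have "compact (S \<inter> sphere 0 1)" by (intro closed_Int_compact clS compact_sphere)
  moreover have "continuous_on (S \<inter> sphere 0 1) (\<lambda>x. x \<bullet> (A *v x))"
    by (intro continuous_intros linear_continuous_on matrix_vector_mul_bounded_linear)
  ultimately have "\<exists>u\<in>S \<inter> sphere 0 1. \<forall>x\<in>S \<inter> sphere 0 1. x \<bullet> (A *v x) \<le> u \<bullet> (A *v u)"
    by (intro continuous_attains_sup)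
  then obtain u where u: "u \<in> S" "norm u = 1"
    and max: "\<And>x. x \<in> S \<inter> sphere 0 1 \<Longrightarrow> x \<bullet> (A *v x) \<le> u \<bullet> (A *v u)"
    by auto
  define d where "d = u \<bullet> (A *v u)"
  have q: "x \<bullet> (A *v x) \<le> d * (x \<bullet> x)" if "x \<in> S" for x
  proof (cases "x = 0")
    case False
    have "sgn x \<in> S \<inter> sphere 0 1"
      using S_add[of 0 x "inverse (norm x)"] that False
      by (auto simp: sgn_div_norm S_def norm_sgn divide_inverse_commute)
    then have "sgn x \<bullet> (A *v sgn x) \<le> d" using max d_def by blast
    then have "(norm x * norm x) * (sgn x \<bullet> (A *v sgn x)) \<le> (norm x * norm x) * d"
      by (intro mult_left_mono) auto
    moreover have "(norm x * norm x) * (sgn x \<bullet> (A *v sgn x)) = x \<bullet> (A *v x)"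
      using False by (simp add: sgn_div_norm matrix_vector_mult_scaleR field_simps)
    ultimately show ?thesis by (simp add: norm_eq_sqrt_inner mult.commute)
  qed simp
  \<comment> \<open>\<open>w\<close> is the defect in the eigenvector equation and again lies in
    \<open>S\<close>. Moving from \<open>u\<close> to \<open>u + e *\<^sub>R w\<close> raises the
    form minus \<open>d\<close> times the squared norm by \<open>2 * e * (w \<bullet> w)\<close> at
    first order, which maximality forbids unless \<open>w\<close> vanishes.\<close>
  define w where "w = A *v u + (- d) *\<^sub>R u"
  have wS: "w \<in> S" unfolding w_def by (intro S_add S_A u)
  have "w \<bullet> w \<le> 0"
  proof (rule ccontr)
    assume n: "\<not> w \<bullet> w \<le> 0"
    \<comment> \<open>Makes \<open>e\<close> times the second-order coefficient at most
      \<open>w \<bullet> w\<close> in absolute value, so that the first-order term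
      \<open>2 * (w \<bullet> w)\<close> wins. When that coefficient is 0, any positive
      \<open>e\<close> will do.\<close>
    define e where "e = (if w \<bullet> (A *v w) - d * (w \<bullet> w) = 0 then 1
      else (w \<bullet> w) / \<bar>w \<bullet> (A *v w) - d * (w \<bullet> w)\<bar>)"
    have e: "0 < e" using n by (auto simp: e_def not_le simp del: inner_gt_zero_iff intro!: divide_pos_pos)
    have uu: "u \<bullet> u = 1" using u(2) by (simp add: norm_eq_1)
    have uw: "u \<bullet> (A *v w) = w \<bullet> (A *v u)" using symI[of u w] inner_commute[of "A *v u" w] by linarith
    have ww: "w \<bullet> w = w \<bullet> (A *v u) - d * (u \<bullet> w)"
      by (subst (2) w_def) (simp add: inner_diff_right inner_commute)
    have "(u + e *\<^sub>R w) \<bullet> (A *v (u + e *\<^sub>R w)) \<le> d * ((u + e *\<^sub>R w) \<bullet> (u + e *\<^sub>R w))"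
      by (intro q S_add u wS)
    then have "d + 2 * e * (w \<bullet> (A *v u)) + e\<^sup>2 * (w \<bullet> (A *v w))
        \<le> d * (1 + 2 * e * (u \<bullet> w) + e\<^sup>2 * (w \<bullet> w))"
      by (simp add: inner_add_left inner_add_right matrix_vector_right_distrib
          matrix_vector_mult_scaleR uu uw d_def[symmetric] inner_commute[of w u] power2_eq_square algebra_simps)
    then have "e * (2 * (w \<bullet> w) + e * (w \<bullet> (A *v w) - d * (w \<bullet> w))) \<le> 0"
      unfolding ww by (simp add: power2_eq_square algebra_simps)
    then have "2 * (w \<bullet> w) + e * (w \<bullet> (A *v w) - d * (w \<bullet> w)) \<le> 0"
      using e by (simp add: mult_le_0_iff)
    moreover have "\<bar>e * (w \<bullet> (A *v w) - d * (w \<bullet> w))\<bar> \<le> w \<bullet> w"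
      using n by (auto simp: e_def abs_mult)
    ultimately show False using n by linarith
  qed
  then have "w = 0" using inner_gt_zero_iff[of w] by linarith
  then have "A *v u = d *\<^sub>R u" by (simp add: w_def)
  moreover have "u \<notin> B" using u by (auto simp: S_def norm_eq_1)
  ultimately show ?case
    using B u by (intro exI[of _ "insert u B"])
      (auto simp: pairwise_insert S_def orthogonal_def[of u] orthogonal_def[of _ u] inner_commute[of u])
qed

lemma spectral_decomposition:
  fixes A :: "real^'n^'n"
  assumes "transpose A = A"
  obtains U d where "orthogonal_matrix U" "A = U ** diag_mat d ** transpose U"
proof -
  obtain B where B: "finite B" "card B = CARD('n)" "pairwise orthogonal B"
    "\<And>b. b \<in> B \<Longrightarrow> norm b = 1" "\<And>b. b \<in> B \<Longrightarrow> \<exists>d. A *v b = d *\<^sub>R b"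
    using orthonormal_eigenvectors[OF assms order_refl] by auto
  obtain f where f: "bij_betw f (UNIV::'n set) B"
    using B by (metis finite_class.finite_UNIV finite_same_card_bij)
  define U where "U = (\<chi> i j. f j $ i)"
  have col: "column i U = f i" for i by (simp add: U_def column_def)
  have fB: "f i \<in> B" for i using f by (auto simp: bij_betw_def)
  have U: "orthogonal_matrix U"
    unfolding orthogonal_matrix_orthonormal_columns col
  proof (intro conjI allI impI)
    fix i j :: 'n assume "i \<noteq> j"
    then have "f i \<noteq> f j" using bij_betw_imp_inj_on[OF f] by (simp add: inj_eq)
    then show "orthogonal (f i) (f j)" by (rule pairwiseD[OF B(3) fB fB])
  qed (rule B(4)[OF fB])
  have "\<forall>i. \<exists>c. A *v f i = c *\<^sub>R f i" using B(5)[OF fB] by blast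
  from choice[OF this] obtain d where d: "A *v f i = d i *\<^sub>R f i" for i by blast
  have "A ** U = U ** diag_mat d"
  proof (simp only: vec_eq_iff, intro allI)
    fix i j
    have "(A ** U) $ i $ j = (A *v f j) $ i"
      by (simp add: matrix_matrix_mult_def matrix_vector_mult_def U_def)
    also have "\<dots> = (U ** diag_mat d) $ i $ j"
      unfolding d by (simp add: matrix_matrix_mult_def U_def diag_mat_def if_distrib cong: if_cong)
    finally show "(A ** U) $ i $ j = (U ** diag_mat d) $ i $ j" .
  qed
  then have "A ** (U ** transpose U) = U ** diag_mat d ** transpose U"
    by (simp add: matrix_mul_assoc)
  then show thesis using that U by (simp add: orthogonal_matrix_def)
qed

lemma pos_def_spectral:
  fixes A :: "real^'n^'n"
  assumes "pos_def A"
  obtains U d where "orthogonal_matrix U" "\<And>i. 0 < d i" "A = U ** diag_mat d ** transpose U"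
proof -
  obtain U d where U: "orthogonal_matrix U" and A: "A = U ** diag_mat d ** transpose U"
    using spectral_decomposition assms unfolding pos_def_def by metis
  have "0 < d i" for i
  proof -
    have n: "U *v axis i 1 \<noteq> 0"
    proof
      assume "U *v axis i 1 = 0"
      then have "transpose U *v (U *v axis i 1) = 0" by simp
      then have "axis i 1 = (0 :: real^'n)"
        using U by (simp add: matrix_vector_mul_assoc orthogonal_matrix_def del: transpose_matrix_vector)
      then show False by (simp add: axis_eq_0_iff)
    qed
    have "(U *v axis i 1) \<bullet> (A *v (U *v axis i 1)) = axis i 1 \<bullet> (diag_mat d *v axis i 1)"
      using U unfolding A inner_matrix_vector_mult matrix_vector_mul_assoc orthogonal_matrix_def
      by (simp add: matrix_mul_assoc) (simp add: matrix_mul_assoc[symmetric])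
    also have "\<dots> = d i" by (simp add: diag_mat_mult_vector inner_axis')
    finally show ?thesis using n assms unfolding pos_def_def by metis
  qed
  then show thesis using that U A by blast
qed

lemma pos_def_congruence:
  fixes A S :: "real^'n^'n"
  assumes "invertible A" "pos_def S"
  shows "pos_def (A ** S ** transpose A)"
  unfolding pos_def_def
proof safe
  show "transpose (A ** S ** transpose A) = A ** S ** transpose A"
    using assms(2) by (simp add: matrix_transpose_mul matrix_mul_assoc pos_def_def)
  fix x :: "real^'n" assume x: "x \<noteq> 0"
  have "transpose A *v x \<noteq> 0"
    using matrix_inv_mult_vector(1)[of "transpose A" x] assms(1) x
    by (metis matrix_vector_mult_0_right transpose_invertible)
  then have "0 < (transpose A *v x) \<bullet> (S *v (transpose A *v x))"
    using assms(2) unfolding pos_def_def by blast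
  also have "\<dots> = x \<bullet> ((A ** S ** transpose A) *v x)"
    unfolding inner_matrix_vector_mult transpose_transpose matrix_vector_mul_assoc
    by (simp add: matrix_mul_assoc)
  finally show "0 < x \<bullet> ((A ** S ** transpose A) *v x)" .
qed

section \<open>Linear images of Lebesgue measure and of Gaussian laws\<close>

lemma measurable_matrix_vector_mult [measurable]: "(*v) A \<in> borel_measurable borel"
  for A :: "real^'n^'m"
  by (intro borel_measurable_continuous_onI linear_continuous_on matrix_vector_mul_bounded_linear)

lemma measurable_vec_nth [measurable]: "(\<lambda>x::real^'n. x $ k) \<in> borel_measurable borel"
  by (intro borel_measurable_continuous_onI continuous_intros)

text \<open>Uniqueness of Haar measure: evaluate the integral of
  \<open>indicator A (x + y) * indicator (ball 0 1) y\<close> against \<open>lborel \<Otimes> M\<close> in both orders.\<close>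

lemma translation_invariant_emeasure:
  fixes M :: "'a::euclidean_space measure"
  assumes sets [measurable_cong]: "sets M = sets borel" and "sigma_finite_measure M"
    and inv: "\<And>c. distr M borel ((+) c) = M" and A [measurable]: "A \<in> sets borel"
  shows "emeasure M A * emeasure lborel (ball 0 1 :: 'a set) = emeasure lborel A * emeasure M (ball 0 1)"
proof -
  interpret M: sigma_finite_measure M by fact
  interpret pair_sigma_finite lborel M ..
  let ?B = "ball 0 1 :: 'a set"
  have [measurable]: "?B \<in> sets borel" by simp
  have trM: "(\<integral>\<^sup>+y. f (c + y) \<partial>M) = (\<integral>\<^sup>+y. f y \<partial>M)" if [measurable]: "f \<in> borel_measurable borel" for f c
    by (subst (2) inv[of c, symmetric]) (simp add: nn_integral_distr)
  have trL: "(\<integral>\<^sup>+y. f (c + y) \<partial>lborel) = (\<integral>\<^sup>+y. f y \<partial>lborel)"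
    if [measurable]: "f \<in> borel_measurable borel" for f :: "'a \<Rightarrow> ennreal" and c
    by (subst (2) lborel_distr_plus[of c, symmetric]) (simp add: nn_integral_distr)
  have "emeasure lborel A * emeasure M ?B = (\<integral>\<^sup>+y. emeasure lborel A * indicator ?B y \<partial>M)"
    by (subst nn_integral_cmult_indicator) (auto simp: sets)
  also have "\<dots> = (\<integral>\<^sup>+y. (\<integral>\<^sup>+x. indicator A (y + x) * indicator ?B y \<partial>lborel) \<partial>M)"
    by (intro nn_integral_cong) (simp add: nn_integral_multc trL)
  also have "\<dots> = (\<integral>\<^sup>+x. (\<integral>\<^sup>+y. indicator A (y + x) * indicator ?B y \<partial>M) \<partial>lborel)"
    by (rule Fubini') measurable
  also have "\<dots> = (\<integral>\<^sup>+x. (\<integral>\<^sup>+y. indicator A y * indicator ?B (y - x) \<partial>M) \<partial>lborel)"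
  proof (rule nn_integral_cong)
    fix x
    show "(\<integral>\<^sup>+y. indicator A (y + x) * indicator ?B y \<partial>M) = (\<integral>\<^sup>+y. indicator A y * indicator ?B (y - x) \<partial>M)"
      by (subst trM[of "\<lambda>y. indicator A y * indicator ?B (y - x)" x, symmetric])
        (auto simp: add.commute)
  qed
  also have "\<dots> = (\<integral>\<^sup>+y. (\<integral>\<^sup>+x. indicator A y * indicator ?B (y - x) \<partial>lborel) \<partial>M)"
    by (rule Fubini'[symmetric]) measurable
  also have "\<dots> = (\<integral>\<^sup>+y. indicator A y * emeasure lborel ?B \<partial>M)"
  proof (rule nn_integral_cong)
    \<comment> \<open>Shifting by \<open>y\<close> turns the ball around \<open>y\<close> into the
      reflection of the unit ball at 0, which is the unit ball again.\<close>
    fix y :: 'a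
    have "(\<integral>\<^sup>+x. indicator ?B (y - x) \<partial>lborel) = (\<integral>\<^sup>+x. indicator ?B (y - (y + x)) \<partial>lborel :: ennreal)"
      by (subst trL[of "\<lambda>x. indicator ?B (y - x)" y]) auto
    also have "\<dots> = (\<integral>\<^sup>+x. indicator ?B x \<partial>lborel)"
      by (intro nn_integral_cong) (simp add: indicator_def)
    finally show "(\<integral>\<^sup>+x. indicator A y * indicator ?B (y - x) \<partial>lborel) = indicator A y * emeasure lborel ?B"
      by (simp add: nn_integral_cmult)
  qed
  also have "\<dots> = emeasure M A * emeasure lborel ?B"
    by (subst nn_integral_multc) (auto simp: sets)
  finally show ?thesis by simp
qed

text \<open>The image of \<open>lborel\<close> under \<open>A\<close> is translation invariant,
  because a shift by \<open>c\<close> is the image of a shift by \<open>matrix_inv A *v c\<close>;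
  it is sigma-finite, because the inverse matrix maps it back to \<open>lborel\<close>. So
  uniqueness of Haar measure applies.\<close>

lemma emeasure_distr_lborel_linear:
  fixes A :: "real^'n^'n"
  assumes A: "invertible A" and S: "S \<in> sets borel"
  shows "emeasure (distr lborel borel ((*v) A)) S * emeasure lborel (ball 0 1 :: (real^'n) set) =
    emeasure lborel S * emeasure lborel ((*v) A -` ball 0 1)"
proof -
  let ?M = "distr lborel borel ((*v) A)"
  have "distr ?M lborel ((*v) (matrix_inv A)) = lborel"
    using A by (subst distr_distr) (auto simp: comp_def matrix_inv_mult_vector distr_id2)
  then have "sigma_finite_measure ?M"
    by (intro sigma_finite_measure_distr[of ?M lborel "(*v) (matrix_inv A)"])
      (simp_all add: lborel.sigma_finite_measure_axioms)
  moreover have "distr ?M borel ((+) c) = ?M" for c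
  proof -
    have "distr ?M borel ((+) c) = distr lborel borel (\<lambda>x. A *v (matrix_inv A *v c + x))"
      using A by (subst distr_distr) (auto simp: comp_def matrix_vector_right_distrib matrix_inv_mult_vector)
    also have "\<dots> = distr (distr lborel borel ((+) (matrix_inv A *v c))) borel ((*v) A)"
      by (subst distr_distr) (auto simp: comp_def)
    finally show ?thesis by (simp add: lborel_distr_plus)
  qed
  ultimately have "emeasure ?M S * emeasure lborel (ball 0 1 :: (real^'n) set)
      = emeasure lborel S * emeasure ?M (ball 0 1)"
    using S by (intro translation_invariant_emeasure) auto
  then show ?thesis by (simp add: emeasure_distr)
qed

lemma emeasure_lborel_unit_ball:
  "emeasure lborel (ball 0 1 :: 'a::euclidean_space set) \<noteq> 0"
  "emeasure lborel (ball 0 1 :: 'a::euclidean_space set) \<noteq> \<infinity>"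
  using content_ball_pos[of 1 "0 :: 'a"] emeasure_lborel_ball_finite[of "0 :: 'a" 1]
  by (auto simp: measure_def)

text \<open>The preimage of the unit ball contains a ball and is bounded, so its volume relative to
  the unit ball is a positive finite factor. This \<open>c\<close> is the reciprocal of the absolute
  determinant, but its value is never computed: normalisation determines it later.\<close>

lemma distr_lborel_linear:
  fixes A :: "real^'n^'n"
  assumes A: "invertible A"
  obtains c :: ennreal where "c \<noteq> 0" "c \<noteq> \<infinity>"
    "distr lborel borel ((*v) A) = density lborel (\<lambda>_. c)"
proof
  let ?B = "ball 0 1 :: (real^'n) set"
  let ?b = "emeasure lborel ?B"
  let ?c = "emeasure lborel ((*v) A -` ?B) / ?b"
  have op: "open ((*v) A -` ?B)"
    by (intro open_vimage linear_continuous_on matrix_vector_mul_bounded_linear) auto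
  moreover have "0 \<in> (*v) A -` ?B" by simp
  ultimately obtain e where e: "0 < e" "ball 0 e \<subseteq> (*v) A -` ?B"
    by (meson open_contains_ball_eq)
  have "0 < emeasure lborel (ball (0 :: real^'n) e)"
    using content_ball_pos[OF e(1), of "0 :: real^'n"] by (simp add: measure_def enn2real_positive_iff)
  also have "\<dots> \<le> emeasure lborel ((*v) A -` ?B)"
    using e(2) op by (intro emeasure_mono) auto
  finally have nz: "emeasure lborel ((*v) A -` ?B) \<noteq> 0" by auto
  then show "?c \<noteq> 0" using emeasure_lborel_unit_ball[where 'a = "real^'n"] by (simp add: ennreal_divide_eq_0_iff)
  have "(*v) A -` ?B = (*v) (matrix_inv A) ` ?B"
    using A by (force simp: matrix_inv_mult_vector image_iff)
  then have "bounded ((*v) A -` ?B)" by (simp add: bounded_linear_image)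
  then have "emeasure lborel ((*v) A -` ?B) < \<infinity>" by (rule emeasure_bounded_finite)
  then show "?c \<noteq> \<infinity>" using emeasure_lborel_unit_ball[where 'a = "real^'n"] by (auto simp: ennreal_divide_eq_top_iff)
  show "distr lborel borel ((*v) A) = density lborel (\<lambda>_. ?c)"
  proof (rule measure_eqI)
    fix S assume "S \<in> sets (distr lborel borel ((*v) A))"
    then have S: "S \<in> sets borel" by simp
    have "emeasure (distr lborel borel ((*v) A)) S = emeasure (distr lborel borel ((*v) A)) S * ?b / ?b"
      using emeasure_lborel_unit_ball[where 'a = "real^'n"] by (simp add: mult_divide_eq_ennreal)
    also have "\<dots> = ?c * emeasure lborel S"
      unfolding emeasure_distr_lborel_linear[OF A S]
      by (simp add: ennreal_times_divide mult.commute)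
    also have "\<dots> = emeasure (density lborel (\<lambda>_. ?c)) S"
      using S by (simp add: emeasure_density nn_integral_cmult)
    finally show "emeasure (distr lborel borel ((*v) A)) S = emeasure (density lborel (\<lambda>_. ?c)) S" .
  qed simp
qed

lemma orthogonal_matrix_invertible: "orthogonal_matrix U \<Longrightarrow> invertible U"
  for U :: "real^'n^'n"
  unfolding invertible_def orthogonal_matrix_def by blast

lemma norm_orthogonal_matrix: "orthogonal_matrix U \<Longrightarrow> norm (U *v x) = norm x"
  for U :: "real^'n^'n"
  using orthogonal_transformation_matrix[of "(*v) U"] orthogonal_transformation_norm
  by (metis matrix_of_matrix_vector_mul matrix_vector_mul_linear)

text \<open>The preimage of the unit ball is the unit ball, so the scaling factor is 1.\<close>

lemma distr_lborel_orthogonal: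
  fixes U :: "real^'n^'n"
  assumes U: "orthogonal_matrix U"
  shows "distr lborel borel ((*v) U) = lborel"
proof (rule measure_eqI)
  fix S assume "S \<in> sets (distr lborel borel ((*v) U))"
  then have S: "S \<in> sets borel" by simp
  have "(*v) U -` ball 0 1 = ball 0 1" by (auto simp: norm_orthogonal_matrix[OF U])
  with emeasure_distr_lborel_linear[OF orthogonal_matrix_invertible[OF U] S]
  have "emeasure (distr lborel borel ((*v) U)) S * emeasure lborel (ball 0 1 :: (real^'n) set)
     = emeasure lborel S * emeasure lborel (ball 0 1 :: (real^'n) set)" by simp
  then show "emeasure (distr lborel borel ((*v) U)) S = emeasure lborel S"
    using emeasure_lborel_unit_ball[where 'a = "real^'n"]
    by (auto simp: ennreal_mult_cancel_left mult.commute[of _ "emeasure lborel (ball 0 1)"])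
qed simp

lemma nn_integral_lborel_prod_cart:
  fixes f :: "'n::finite \<Rightarrow> real \<Rightarrow> ennreal"
  assumes [measurable]: "\<And>i. f i \<in> borel_measurable borel"
  shows "(\<integral>\<^sup>+x. (\<Prod>i\<in>UNIV. f i (x $ i)) \<partial>(lborel :: (real^'n) measure)) = (\<Prod>i\<in>UNIV. \<integral>\<^sup>+t. f i t \<partial>lborel)"
proof -
  \<comment> \<open>Relabels the factors by basis vectors, as the product formula over
    \<open>Basis\<close> requires; \<open>axis\<close> is injective, so \<open>THE\<close> picks the
    right index.\<close>
  define g where "g b = f (THE i. b = axis i (1::real))" for b :: "real^'n"
  have g: "g (axis i 1) = f i" for i unfolding g_def by (simp add: axis_eq_axis)
  have Basis: "Basis = (\<lambda>i. axis i (1::real) :: real^'n) ` UNIV" by (auto simp: Basis_vec_def)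
  have inj: "inj (\<lambda>i. axis i (1::real) :: real^'n)" by (auto simp: inj_def axis_eq_axis)
  have "(\<integral>\<^sup>+x. (\<Prod>b\<in>Basis. g b (x \<bullet> b)) \<partial>(lborel :: (real^'n) measure)) = (\<Prod>b\<in>Basis. \<integral>\<^sup>+t. g b t \<partial>lborel)"
    by (rule nn_integral_lborel_prod) (auto simp: Basis g)
  then show ?thesis
    by (simp add: Basis prod.reindex[OF inj] g inner_axis)
qed

lemma quadratic_form_inverse_spectral:
  fixes U :: "real^'n^'n"
  assumes U: "orthogonal_matrix U" and d: "\<And>i. 0 < d i"
    and A: "A = U ** diag_mat d ** transpose U" "invertible A"
  shows "(U *v y) \<bullet> (matrix_inv A *v (U *v y)) = (\<Sum>i\<in>UNIV. (y $ i)\<^sup>2 / d i)"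
proof -
  \<comment> \<open>In the eigenbasis \<open>z\<close> is the inverse diagonal applied to
    \<open>y\<close>. Checking that \<open>A\<close> maps \<open>U *v z\<close> to
    \<open>U *v y\<close> replaces inverting the threefold product.\<close>
  define z where "z = (\<chi> i. y $ i / d i)"
  have dz: "diag_mat d *v z = y"
    using d by (simp add: diag_mat_mult_vector z_def vec_eq_iff less_imp_neq[symmetric])
  have UU: "transpose U *v (U *v x) = x" for x
    using U by (simp add: matrix_vector_mul_assoc orthogonal_matrix_def del: transpose_matrix_vector)
  have "A *v (U *v z) = U *v (diag_mat d *v (transpose U *v (U *v z)))"
    unfolding A(1) matrix_vector_mul_assoc[symmetric] ..
  also have "\<dots> = U *v y" by (simp only: UU dz)
  finally have "matrix_inv A *v (U *v y) = U *v z"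
    using matrix_inv_mult_vector(1)[OF A(2), of "U *v z"] by simp
  then have "(U *v y) \<bullet> (matrix_inv A *v (U *v y)) = y \<bullet> z"
    by (simp only: inner_matrix_vector_mult UU)
  then show ?thesis by (simp add: inner_vec_def z_def power2_eq_square)
qed

section \<open>Multivariate Gaussian densities and their affine images\<close>

lemma measurable_mv_normal_density [measurable]: "mv_normal_density \<mu> S \<in> borel_measurable borel"
proof -
  have "continuous_on UNIV (\<lambda>x. matrix_inv S *v (x - \<mu>))"
    by (intro bounded_linear.continuous_on[OF matrix_vector_mul_bounded_linear] continuous_intros)
  then show ?thesis
    unfolding mv_normal_density_def divide_inverse
    by (intro borel_measurable_continuous_onI continuous_intros)
qed



lemma det_orthogonal_congruence:
  fixes U :: "real^'n^'n"
  assumes "orthogonal_matrix U"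
  shows "det (U ** D ** transpose U) = det D"
proof -
  show ?thesis
    using det_orthogonal_matrix[OF assms] unfolding det_mul det_transpose by (elim disjE) simp_all
qed

lemma pos_def_det_pos:
  assumes "pos_def A"
  shows "0 < det A"
proof -
  from pos_def_spectral[OF assms] obtain U d where
    "orthogonal_matrix U" "\<And>i. 0 < d i" "A = U ** diag_mat d ** transpose U" by metis
  then show ?thesis by (simp add: det_orthogonal_congruence det_diag_mat prod_pos)
qed

lemma sqrt_prod: "sqrt (\<Prod>i\<in>I. f i) = (\<Prod>i\<in>I. sqrt (f i))"
  by (induction I rule: infinite_finite_induct) (auto simp: real_sqrt_mult)

text \<open>In eigenbasis coordinates the exponent becomes a sum and the determinant a product. The
  factorisation reduces total mass and marginals to one-dimensional integrals.\<close>

lemma mv_normal_density_spectral: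
  fixes U :: "real^'n^'n"
  assumes U: "orthogonal_matrix U" and d: "\<And>i. 0 < d i"
    and A: "A = U ** diag_mat d ** transpose U" "pos_def A"
  shows "mv_normal_density 0 A (U *v y) = (\<Prod>i\<in>UNIV. normal_density 0 (sqrt (d i)) (y $ i))"
proof -
  have "mv_normal_density 0 A (U *v y) =
      exp (\<Sum>i\<in>UNIV. - (y $ i)\<^sup>2 / (2 * d i)) / sqrt (\<Prod>i\<in>UNIV. 2 * pi * d i)"
    unfolding mv_normal_density_def
    using quadratic_form_inverse_spectral[OF U d A(1) pos_def_invertible[OF A(2)]]
    by (simp add: A(1) det_orthogonal_congruence U det_diag_mat prod.distrib sum_negf[symmetric]
        sum_divide_distrib mult.commute)
  also have "\<dots> = (\<Prod>i\<in>UNIV. normal_density 0 (sqrt (d i)) (y $ i))"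
    using d by (simp add: normal_density_def exp_sum prod_dividef sqrt_prod less_imp_le)
  finally show ?thesis .
qed

lemma prob_space_mv_normal_0:
  fixes A :: "real^'n^'n"
  assumes A: "pos_def A"
  shows "prob_space (mv_normal 0 A)"
proof
  from pos_def_spectral[OF A] obtain U d where
    U: "orthogonal_matrix U" and d: "\<And>i. 0 < d i" and eq: "A = U ** diag_mat d ** transpose U"
    by metis
  have "emeasure (mv_normal 0 A) (space (mv_normal 0 A)) = (\<integral>\<^sup>+x. mv_normal_density 0 A x \<partial>lborel)"
    by (simp add: mv_normal_def emeasure_density)
  also have "\<dots> = (\<integral>\<^sup>+x. mv_normal_density 0 A (U *v x) \<partial>lborel)"
    by (subst distr_lborel_orthogonal[OF U, symmetric]) (simp add: nn_integral_distr)
  also have "\<dots> = (\<integral>\<^sup>+y. (\<Prod>i\<in>UNIV. ennreal (normal_density 0 (sqrt (d i)) (y $ i))) \<partial>(lborel :: (real^'n) measure))"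
    by (simp add: mv_normal_density_spectral[OF U d eq A] prod_ennreal)
  also have "\<dots> = (\<Prod>i\<in>UNIV. \<integral>\<^sup>+t. normal_density 0 (sqrt (d i)) t \<partial>lborel)"
    by (rule nn_integral_lborel_prod_cart) measurable
  also have "\<dots> = 1"
  proof (rule prod.neutral, safe)
    fix i
    interpret prob_space "density lborel (normal_density 0 (sqrt (d i)))"
      using d by (intro prob_space_normal_density) simp
    show "(\<integral>\<^sup>+t. normal_density 0 (sqrt (d i)) t \<partial>lborel) = 1"
      using emeasure_space_1 by (simp add: emeasure_density)
  qed
  finally show "emeasure (mv_normal 0 A) (space (mv_normal 0 A)) = 1" .
qed

lemma mv_normal_density_shift: "mv_normal_density \<mu> A x = mv_normal_density 0 A (x - \<mu>)"
  by (simp add: mv_normal_density_def)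

lemma space_mv_normal [simp]: "space (mv_normal \<mu> A) = UNIV"
  and sets_mv_normal [simp, measurable_cong]: "sets (mv_normal \<mu> A) = sets borel"
  by (simp_all add: mv_normal_def)

lemma prob_space_mv_normal:
  assumes A: "pos_def A"
  shows "prob_space (mv_normal \<mu> A)"
proof
  interpret N: prob_space "mv_normal 0 A" by (rule prob_space_mv_normal_0[OF A])
  have "emeasure (mv_normal \<mu> A) (space (mv_normal \<mu> A)) = (\<integral>\<^sup>+x. mv_normal_density \<mu> A x \<partial>lborel)"
    by (simp add: mv_normal_def emeasure_density)
  also have "\<dots> = (\<integral>\<^sup>+x. mv_normal_density \<mu> A (\<mu> + x) \<partial>lborel)"
    by (subst lborel_distr_plus[of \<mu>, symmetric]) (simp add: nn_integral_distr)
  also have "\<dots> = emeasure (mv_normal 0 A) (space (mv_normal 0 A))"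
    by (subst mv_normal_density_shift) (simp add: mv_normal_def emeasure_density)
  also have "\<dots> = 1" by (rule N.emeasure_space_1)
  finally show "emeasure (mv_normal \<mu> A) (space (mv_normal \<mu> A)) = 1" .
qed

lemma quadratic_form_congruence:
  fixes A S :: "real^'n^'n"
  assumes A: "invertible A" and S: "pos_def S"
  shows "(A *v v) \<bullet> (matrix_inv (A ** S ** transpose A) *v (A *v v)) = v \<bullet> (matrix_inv S *v v)"
proof -
  \<comment> \<open>The expected value of the inverse congruence at \<open>A *v v\<close>; the
    factors \<open>A\<close> cancel against their inverses on both sides of the form.\<close>
  define w where "w = transpose (matrix_inv A) *v (matrix_inv S *v v)"
  have At: "transpose A ** transpose (matrix_inv A) = mat 1"
    by (simp add: matrix_transpose_mul[symmetric] matrix_inv_left[OF A])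
  have "(A ** S ** transpose A) *v w = A *v (S *v ((transpose A ** transpose (matrix_inv A)) *v (matrix_inv S *v v)))"
    unfolding w_def by (simp only: matrix_vector_mul_assoc matrix_mul_assoc)
  also have "\<dots> = A *v v"
    by (simp add: At matrix_inv_mult_vector pos_def_invertible[OF S])
  finally have "matrix_inv (A ** S ** transpose A) *v (A *v v) = w"
    using matrix_inv_mult_vector(1)[OF pos_def_invertible[OF pos_def_congruence[OF A S]], of w] by simp
  moreover have "(A *v v) \<bullet> w = v \<bullet> ((transpose A ** transpose (matrix_inv A)) *v (matrix_inv S *v v))"
    unfolding w_def inner_matrix_vector_mult by (simp only: matrix_vector_mul_assoc matrix_mul_assoc)
  ultimately show ?thesis by (simp add: At)
qed

text \<open>The Jacobian and the two normalising constants need not be matched: both sides are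
  probability measures with proportional densities.\<close>

lemma distr_mv_normal_affine:
  fixes A S :: "real^'n^'n"
  assumes A: "invertible A" and S: "pos_def S"
  shows "distr (mv_normal \<mu> S) borel (\<lambda>x. b + A *v x) = mv_normal (b + A *v \<mu>) (A ** S ** transpose A)"
proof -
  let ?S' = "A ** S ** transpose A" and ?\<mu>' = "b + A *v \<mu>"
  let ?T = "\<lambda>x. b + A *v x"
  let ?f = "mv_normal_density \<mu> S" and ?g = "mv_normal_density ?\<mu>' ?S'"
  have S': "pos_def ?S'" by (rule pos_def_congruence[OF A S])
  define k where "k = sqrt (det ?S') / sqrt (det S)"
  have k: "0 < k" using pos_def_det_pos[OF S] pos_def_det_pos[OF S'] by (simp add: k_def)
  have fg: "?f x = k * ?g (?T x)" for x
  proof -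
    have "(?T x - ?\<mu>') = A *v (x - \<mu>)" by (simp add: matrix_vector_mult_diff_distrib)
    then show ?thesis
      unfolding mv_normal_density_def
      using quadratic_form_congruence[OF A S, of "x - \<mu>"] pos_def_det_pos[OF S] pos_def_det_pos[OF S']
      by (simp add: k_def real_sqrt_mult)
  qed
  obtain c where c: "c \<noteq> 0" "c \<noteq> \<infinity>" "distr lborel borel ((*v) A) = density lborel (\<lambda>_. c)"
    using distr_lborel_linear[OF A] by blast
  have "emeasure (distr (mv_normal \<mu> S) borel ?T) B = (ennreal k * c) * emeasure (mv_normal ?\<mu>' ?S') B"
    if [measurable]: "B \<in> sets borel" for B
  proof -
    have "emeasure (distr (mv_normal \<mu> S) borel ?T) B
        = (\<integral>\<^sup>+y. indicator B y \<partial>distr (mv_normal \<mu> S) borel ?T)"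
      by (simp add: nn_integral_indicator)
    also have "\<dots> = (\<integral>\<^sup>+x. ennreal (?f x) * indicator B (?T x) \<partial>lborel)"
      unfolding mv_normal_def by (subst nn_integral_distr) (simp_all add: nn_integral_density)
    also have "\<dots> = (\<integral>\<^sup>+x. ennreal k * (ennreal (?g (?T x)) * indicator B (?T x)) \<partial>lborel)"
      using k by (simp add: fg ennreal_mult' mult.assoc)
    also have "\<dots> = ennreal k * (\<integral>\<^sup>+x. ennreal (?g (b + x)) * indicator B (b + x) \<partial>distr lborel borel ((*v) A))"
      by (simp add: nn_integral_cmult nn_integral_distr)
    also have "\<dots> = ennreal k * (c * (\<integral>\<^sup>+x. ennreal (?g (b + x)) * indicator B (b + x) \<partial>lborel))"
      unfolding c by (simp add: nn_integral_density nn_integral_cmult)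
    also have "(\<integral>\<^sup>+x. ennreal (?g (b + x)) * indicator B (b + x) \<partial>lborel) = (\<integral>\<^sup>+x. ennreal (?g x) * indicator B x \<partial>lborel)"
      by (subst (2) lborel_distr_plus[of b, symmetric]) (simp add: nn_integral_distr)
    also have "\<dots> = emeasure (mv_normal ?\<mu>' ?S') B"
      by (simp add: mv_normal_def emeasure_density)
    finally show ?thesis by (simp add: mult.assoc)
  qed
  note * = this
  interpret N: prob_space "mv_normal \<mu> S" by (rule prob_space_mv_normal[OF S])
  interpret N': prob_space "mv_normal ?\<mu>' ?S'" by (rule prob_space_mv_normal[OF S'])
  interpret D: prob_space "distr (mv_normal \<mu> S) borel ?T" by (rule N.prob_space_distr) simp
  have "ennreal k * c = 1"
    using *[of UNIV] D.emeasure_space_1 N'.emeasure_space_1 by simp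
  then show ?thesis
    by (intro measure_eqI) (simp_all add: *)
qed

section \<open>One-dimensional projections and monotone transport\<close>

abbreviation normal_law :: "real \<Rightarrow> real \<Rightarrow> real measure" where
  "normal_law a s \<equiv> density lborel (\<lambda>x. ennreal (normal_density a s x))"

lemma distr_normal_law_affine:
  assumes "0 < s" "c \<noteq> 0"
  shows "distr (normal_law a s) borel (\<lambda>x. b + c * x) = normal_law (b + c * a) (\<bar>c\<bar> * s)"
proof -
  interpret prob_space "normal_law a s" by (rule prob_space_normal_density) fact
  have "distributed (normal_law a s) lborel (\<lambda>x. x) (normal_density a s)"
    by (auto simp: distributed_def distr_id2)
  from normal_density_affine[OF this assms, of b] show ?thesis
    by (simp add: distributed_def cong: distr_cong)
qed

section \<open>Marginals of Gaussian laws\<close>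

lemma distr_mv_normal_coordinate:
  "distr (mv_normal 0 (mat 1 :: real^'n^'n)) borel (\<lambda>x. x $ k) = normal_law 0 1"
proof (rule measure_eqI)
  fix B assume "B \<in> sets (distr (mv_normal 0 (mat 1 :: real^'n^'n)) borel (\<lambda>x. x $ k))"
  then have [measurable]: "B \<in> sets borel" by simp
  have "diag_mat (\<lambda>_. 1) = (mat 1 :: real^'n^'n)"
    by (auto simp: diag_mat_def mat_def vec_eq_iff)
  then have I: "mat 1 = (mat 1 :: real^'n^'n) ** diag_mat (\<lambda>_. 1) ** transpose (mat 1)"
    by simp
  have pI: "pos_def (mat 1 :: real^'n^'n)" by (simp add: pos_def_def)
  have d: "mv_normal_density 0 (mat 1) x = (\<Prod>i\<in>UNIV. std_normal_density (x $ i))" for x :: "real^'n"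
    using mv_normal_density_spectral[OF _ _ I pI, of x] by (simp add: orthogonal_matrix_id)
  \<comment> \<open>The event is put into the factor of index \<open>k\<close>, which keeps the
    integrand a product; each other factor integrates to 1.\<close>
  let ?f = "\<lambda>i t. ennreal (std_normal_density t) * (if i = k then indicator B t else 1)"
  have N: "(\<integral>\<^sup>+t. std_normal_density t \<partial>lborel) = 1"
  proof -
    interpret prob_space "normal_law 0 1" by (rule prob_space_normal_density) simp
    show ?thesis using emeasure_space_1 by (simp add: emeasure_density)
  qed
  have "emeasure (distr (mv_normal 0 (mat 1 :: real^'n^'n)) borel (\<lambda>x. x $ k)) B
      = (\<integral>\<^sup>+y. indicator B y \<partial>distr (mv_normal 0 (mat 1 :: real^'n^'n)) borel (\<lambda>x. x $ k))"
    by (simp add: nn_integral_indicator)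
  also have "\<dots> = (\<integral>\<^sup>+x. ennreal (mv_normal_density 0 (mat 1) x) * indicator B (x $ k) \<partial>(lborel :: (real^'n) measure))"
    unfolding mv_normal_def by (subst nn_integral_distr) (simp_all add: nn_integral_density)
  also have "\<dots> = (\<integral>\<^sup>+x. (\<Prod>i\<in>UNIV. ?f i (x $ i)) \<partial>(lborel :: (real^'n) measure))"
    by (intro nn_integral_cong) (simp add: d prod.distrib prod_ennreal[symmetric])
  also have "\<dots> = (\<Prod>i\<in>UNIV. \<integral>\<^sup>+t. ?f i t \<partial>lborel)"
    by (rule nn_integral_lborel_prod_cart) measurable
  also have "\<dots> = (\<Prod>i\<in>UNIV. if i = k then emeasure (normal_law 0 1) B else 1)"
    by (intro prod.cong) (auto simp: emeasure_density N)
  also have "\<dots> = emeasure (normal_law 0 1) B" by simp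
  finally show "emeasure (distr (mv_normal 0 (mat 1 :: real^'n^'n)) borel (\<lambda>x. x $ k)) B
    = emeasure (normal_law 0 1) B" .
qed simp

lemma norm_axis: "norm (axis k c :: real^'n) = \<bar>c\<bar>"
  by (simp add: norm_eq_sqrt_inner inner_axis_axis)

text \<open>A factor \<open>C\<close> with \<open>C ** transpose C = S\<close> stays one when
  multiplied on the right by an orthogonal matrix. This freedom rotates
  \<open>transpose C *v \<theta>\<close> onto a coordinate axis. For standard normal
  \<open>z\<close>, the projection of \<open>A *v z\<close> along \<open>\<theta>\<close> then
  involves the single coordinate \<open>z $ k\<close>.\<close>

lemma pos_def_factor_along:
  fixes S :: "real^'n^'n"
  assumes S: "pos_def S"
  obtains A :: "real^'n^'n" where "invertible A" "A ** transpose A = S"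
    "transpose A *v \<theta> = axis k (sqrt (\<theta> \<bullet> (S *v \<theta>)))"
proof -
  from pos_def_spectral[OF S] obtain U d where
    U: "orthogonal_matrix U" and d: "\<And>i. 0 < d i" and eq: "S = U ** diag_mat d ** transpose U"
    by metis
  define C where "C = U ** diag_mat (\<lambda>i. sqrt (d i))"
  have "diag_mat (\<lambda>i. sqrt (d i)) ** diag_mat (\<lambda>i. sqrt (d i)) = diag_mat d"
    using d by (simp add: matrix_eq matrix_vector_mul_assoc[symmetric] diag_mat_mult_vector
        mult.assoc[symmetric] less_imp_le)
  then have CC: "C ** transpose C = S"
    unfolding C_def eq matrix_transpose_mul transpose_diag_mat by (metis matrix_mul_assoc)
  define u where "u = transpose C *v \<theta>"
  have "norm u = sqrt (\<theta> \<bullet> (S *v \<theta>))"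
    unfolding norm_eq_sqrt_inner u_def inner_matrix_vector_mult transpose_transpose
      matrix_vector_mul_assoc CC ..
  then have "norm (axis k (sqrt (\<theta> \<bullet> (S *v \<theta>))) :: real^'n) = norm u"
    by (metis norm_axis norm_ge_zero abs_of_nonneg)
  then obtain f where f: "orthogonal_transformation f" "f (axis k (sqrt (\<theta> \<bullet> (S *v \<theta>)))) = u"
    using orthogonal_transformation_exists by metis
  define V where "V = matrix f"
  have V: "orthogonal_matrix V" "V *v axis k (sqrt (\<theta> \<bullet> (S *v \<theta>))) = u"
    using f unfolding V_def orthogonal_transformation_matrix by auto
  show thesis
  proof
    show AA: "(C ** V) ** transpose (C ** V) = S"
      using V(1) unfolding matrix_transpose_mul orthogonal_matrix_def
      by (metis CC matrix_mul_assoc matrix_mul_rid)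
    have "(C ** V) ** (transpose (C ** V) ** matrix_inv S) = mat 1"
      unfolding matrix_mul_assoc AA by (rule matrix_inv_right[OF pos_def_invertible[OF S]])
    then show "invertible (C ** V)" using invertible_right_inverse by blast
    have "transpose (C ** V) *v \<theta> = transpose V *v u"
      unfolding u_def matrix_transpose_mul matrix_vector_mul_assoc ..
    also have "\<dots> = (transpose V ** V) *v axis k (sqrt (\<theta> \<bullet> (S *v \<theta>)))"
      unfolding V(2)[symmetric] matrix_vector_mul_assoc ..
    also have "\<dots> = axis k (sqrt (\<theta> \<bullet> (S *v \<theta>)))"
      using V(1) by (simp add: orthogonal_matrix_def)
    finally show "transpose (C ** V) *v \<theta> = axis k (sqrt (\<theta> \<bullet> (S *v \<theta>)))" .
  qed
qed

lemma projected_law_mv_normal: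
  fixes S :: "real^'n^'n"
  assumes S: "pos_def S" and \<theta>: "\<theta> \<noteq> 0"
  shows "projected_law \<theta> (mv_normal \<mu> S) = normal_law (\<theta> \<bullet> \<mu>) (sqrt (\<theta> \<bullet> (S *v \<theta>)))"
proof -
  define s where "s = sqrt (\<theta> \<bullet> (S *v \<theta>))"
  have s: "0 < s" using S \<theta> unfolding s_def pos_def_def by auto
  \<comment> \<open>An arbitrary index: the rotated axis may be any coordinate axis.\<close>
  obtain k :: 'n where True by blast
  obtain A where A: "invertible A" "A ** transpose A = S" "transpose A *v \<theta> = axis k s"
    using pos_def_factor_along[OF S, of \<theta> k] unfolding s_def by metis
  have pI: "pos_def (mat 1 :: real^'n^'n)" by (simp add: pos_def_def)
  have "mv_normal \<mu> S = distr (mv_normal 0 (mat 1)) borel (\<lambda>z. \<mu> + A *v z)"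
    using distr_mv_normal_affine[OF A(1) pI, of 0 \<mu>] A(2) by simp
  then have "projected_law \<theta> (mv_normal \<mu> S)
      = distr (mv_normal 0 (mat 1)) borel (\<lambda>z. \<theta> \<bullet> (\<mu> + A *v z))"
    unfolding projected_law_def by (simp add: distr_distr comp_def)
  also have "(\<lambda>z. \<theta> \<bullet> (\<mu> + A *v z)) = (\<lambda>z. \<theta> \<bullet> \<mu> + s * z $ k)"
  proof
    fix z
    have "\<theta> \<bullet> (A *v z) = (transpose A *v \<theta>) \<bullet> z"
      unfolding inner_matrix_vector_mult transpose_transpose ..
    also have "\<dots> = s * z $ k" unfolding A(3) by (simp add: inner_axis')
    finally show "\<theta> \<bullet> (\<mu> + A *v z) = \<theta> \<bullet> \<mu> + s * z $ k" by (simp add: inner_add_right)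
  qed
  also have "distr (mv_normal 0 (mat 1)) borel (\<lambda>z. \<theta> \<bullet> \<mu> + s * z $ k)
      = distr (distr (mv_normal 0 (mat 1)) borel (\<lambda>z. z $ k)) borel (\<lambda>t. \<theta> \<bullet> \<mu> + s * t)"
    by (subst distr_distr) (auto simp: comp_def)
  also have "\<dots> = normal_law (\<theta> \<bullet> \<mu>) s"
    unfolding distr_mv_normal_coordinate using distr_normal_law_affine[of 1 s 0 "\<theta> \<bullet> \<mu>"] s by simp
  finally show ?thesis unfolding s_def .
qed

section \<open>Monotone transport between one-dimensional Gaussians\<close>

lemma normal_law_first_moment:
  assumes "0 < s"
  shows "integrable (normal_law a s) (\<lambda>x. x - a)" "(\<integral>x. x - a \<partial>normal_law a s) = 0"
  using integrable_normal_moment[OF assms, of a 1] integral_normal_moment_odd[OF assms, of a 0]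
  by (simp_all add: integrable_density integral_density)

lemma normal_law_second_moment:
  assumes "0 < s"
  shows "integrable (normal_law a s) (\<lambda>x. (x - a)\<^sup>2)" "(\<integral>x. (x - a)\<^sup>2 \<partial>normal_law a s) = s\<^sup>2"
  using integrable_normal_moment[OF assms, of a 2] integral_normal_moment_even[OF assms, of a 1]
  by (simp_all add: integrable_density integral_density fact_numeral)

definition normal_transport :: "real \<Rightarrow> real \<Rightarrow> real \<Rightarrow> real \<Rightarrow> real \<Rightarrow> real" where
  "normal_transport a s b r x = b + r / s * (x - a)"

lemma transports_normal_transport:
  assumes "0 < s" "0 < r"
  shows "transports (normal_law a s) (normal_law b r) (normal_transport a s b r)"
proof -
  have eq: "normal_transport a s b r = (\<lambda>x. (b - r / s * a) + r / s * x)"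
    by (rule ext) (simp add: normal_transport_def right_diff_distrib)
  show ?thesis
    unfolding eq using distr_normal_law_affine[of s "r / s" a "b - r / s * a"] assms
    by (simp add: transports_def)
qed

text \<open>By change of variables these are moments of the target, hence the same for all competing
  maps.\<close>

lemma transport_moments:
  assumes r: "0 < r" and T: "transports (normal_law a s) (normal_law b r) T"
  shows "integrable (normal_law a s) (\<lambda>x. T x - b)" "(\<integral>x. T x - b \<partial>normal_law a s) = 0"
    "integrable (normal_law a s) (\<lambda>x. (T x - b)\<^sup>2)" "(\<integral>x. (T x - b)\<^sup>2 \<partial>normal_law a s) = r\<^sup>2"
proof -
  have T: "T \<in> borel_measurable (normal_law a s)" "distr (normal_law a s) borel T = normal_law b r"
    using T by (auto simp: transports_def)
  show "integrable (normal_law a s) (\<lambda>x. T x - b)"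
    using integrable_distr[OF T(1), of "\<lambda>y. y - b"] normal_law_first_moment(1)[OF r] T(2) by simp
  show "(\<integral>x. T x - b \<partial>normal_law a s) = 0"
    using integral_distr[OF T(1), of "\<lambda>y. y - b"] normal_law_first_moment(2)[OF r] T(2) by simp
  show "integrable (normal_law a s) (\<lambda>x. (T x - b)\<^sup>2)"
    using integrable_distr[OF T(1), of "\<lambda>y. (y - b)\<^sup>2"] normal_law_second_moment(1)[OF r] T(2) by simp
  show "(\<integral>x. (T x - b)\<^sup>2 \<partial>normal_law a s) = r\<^sup>2"
    using integral_distr[OF T(1), of "\<lambda>y. (y - b)\<^sup>2"] normal_law_second_moment(2)[OF r] T(2) by simp
qed

text \<open>The cost splits as \<open>?g x\<close> plus a nonnegative square divided by
  \<open>k\<close>, which is Young's inequality for the cross term with weight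
  \<open>k = r / s\<close>. Here \<open>?g\<close> separates into a function of \<open>x\<close> and
  a function of \<open>T x\<close>, so its integral depends on moments only and is common to all
  transports; the square vanishes for the affine map.\<close>

lemma transport_cost:
  assumes s: "0 < s" and r: "0 < r" and T: "transports (normal_law a s) (normal_law b r) T"
  shows "ennreal ((s - r)\<^sup>2 + (a - b)\<^sup>2) \<le> (\<integral>\<^sup>+x. ennreal ((x - T x)\<^sup>2) \<partial>normal_law a s)"
    and "T = normal_transport a s b r \<Longrightarrow>
      (\<integral>\<^sup>+x. ennreal ((x - T x)\<^sup>2) \<partial>normal_law a s) = ennreal ((s - r)\<^sup>2 + (a - b)\<^sup>2)"
proof -
  interpret prob_space "normal_law a s" by (rule prob_space_normal_density) fact
  define k where "k = r / s"
  have k: "0 < k" using s r by (simp add: k_def)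
  let ?g = "\<lambda>x. (1 - k) * (x - a)\<^sup>2 + (1 - 1 / k) * (T x - b)\<^sup>2 + (a - b)\<^sup>2
    + 2 * (a - b) * ((x - a) - (T x - b))"
  note mom = normal_law_first_moment[OF s, of a] normal_law_second_moment[OF s, of a]
    transport_moments[OF r T]
  have [measurable]: "T \<in> borel_measurable borel" using T by (simp add: transports_def)
  have ig: "integrable (normal_law a s) ?g"
    by (intro Bochner_Integration.integrable_add Bochner_Integration.integrable_diff
        integrable_mult_right mom integrable_const)
  have "(\<integral>x. ?g x \<partial>normal_law a s) = (1 - k) * s\<^sup>2 + (1 - 1 / k) * r\<^sup>2 + (a - b)\<^sup>2"
    using prob_space by (simp add: mom)
  also have "\<dots> = (s - r)\<^sup>2 + (a - b)\<^sup>2"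
    using s r by (simp add: k_def power2_eq_square field_simps)
  finally have intg: "(\<integral>x. ?g x \<partial>normal_law a s) = (s - r)\<^sup>2 + (a - b)\<^sup>2" .
  have diff: "(x - T x)\<^sup>2 - ?g x = (k * (x - a) - (T x - b))\<^sup>2 / k" for x
    using k by (simp add: power2_eq_square field_simps)
  have le: "?g x \<le> (x - T x)\<^sup>2" for x
    using diff[of x] k by (smt (verit) divide_nonneg_pos zero_le_power2)
  \<comment> \<open>\<open>?g\<close> may take negative values, on which \<open>ennreal\<close> is
    0; dropping the negative part of the integral leaves an inequality in the direction
    needed.\<close>
  have "ennreal (\<integral>x. ?g x \<partial>normal_law a s) \<le> ennreal (enn2real (\<integral>\<^sup>+x. ennreal (?g x) \<partial>normal_law a s))"
    unfolding real_lebesgue_integral_def[OF ig] by (intro ennreal_leI) simp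
  also have "\<dots> \<le> (\<integral>\<^sup>+x. ennreal (?g x) \<partial>normal_law a s)"
    by (simp add: ennreal_enn2real_if)
  also have "\<dots> \<le> (\<integral>\<^sup>+x. ennreal ((x - T x)\<^sup>2) \<partial>normal_law a s)"
    by (intro nn_integral_mono ennreal_leI le)
  finally show "ennreal ((s - r)\<^sup>2 + (a - b)\<^sup>2) \<le> (\<integral>\<^sup>+x. ennreal ((x - T x)\<^sup>2) \<partial>normal_law a s)"
    unfolding intg .
  assume "T = normal_transport a s b r"
  then have eq: "(x - T x)\<^sup>2 = ?g x" for x
    using diff[of x] by (simp add: normal_transport_def k_def)
  then have "integrable (normal_law a s) (\<lambda>x. (x - T x)\<^sup>2)" using ig by simp
  then have "(\<integral>\<^sup>+x. ennreal ((x - T x)\<^sup>2) \<partial>normal_law a s) = ennreal (\<integral>x. (x - T x)\<^sup>2 \<partial>normal_law a s)"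
    by (rule nn_integral_eq_integral) simp
  then show "(\<integral>\<^sup>+x. ennreal ((x - T x)\<^sup>2) \<partial>normal_law a s) = ennreal ((s - r)\<^sup>2 + (a - b)\<^sup>2)"
    unfolding eq intg .
qed

lemma measure_normal_law_Ioc_pos:
  assumes "0 < s" "x < y"
  shows "0 < measure (normal_law a s) {x<..y}"
proof -
  interpret prob_space "normal_law a s" by (rule prob_space_normal_density) fact
  have "emeasure (normal_law a s) {x<..y} \<noteq> 0"
  proof
    assume "emeasure (normal_law a s) {x<..y} = 0"
    then have "AE t in lborel. t \<notin> {x<..y}"
      using normal_density_pos[OF assms(1), of a]
      by (subst (asm) emeasure_density) (auto simp: nn_integral_0_iff_AE less_le_not_le indicator_def
          ennreal_eq_0_iff elim!: eventually_mono dest: leD split: if_splits)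
    then have "emeasure lborel {x<..y} = 0"
      by (subst (asm) AE_iff_measurable[where N = "{x<..y}"]) auto
    then show False using assms(2) by simp
  qed
  then show ?thesis by (simp add: emeasure_eq_measure zero_less_measure_iff)
qed

text \<open>A monotone \<open>T\<close> satisfies \<open>F\<^sub>\<mu> x \<le> F\<^sub>\<nu> (T x)\<close> at every point, and dually for upper tails.\<close>

lemma mono_transport_normal_unique:
  assumes s: "0 < s" and r: "0 < r" and mono: "mono T"
    and T: "transports (normal_law a s) (normal_law b r) T"
  shows "T = normal_transport a s b r"
proof
  fix x
  let ?L = "normal_transport a s b r"
  interpret M: prob_space "normal_law a s" by (rule prob_space_normal_density) fact
  interpret N: prob_space "normal_law b r" by (rule prob_space_normal_density) fact
  have L_le: "?L u \<le> ?L v \<longleftrightarrow> u \<le> v" for u v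
    using s r by (simp add: normal_transport_def divide_le_cancel mult_le_cancel_left)
  have tr: "measure (normal_law b r) B = measure (normal_law a s) (S -` B)"
    if "transports (normal_law a s) (normal_law b r) S" "B \<in> sets borel" for S B
    using that measure_distr[of S "normal_law a s" borel B] by (auto simp: transports_def)
  have meas: "S -` B \<in> sets borel"
    if "transports (normal_law a s) (normal_law b r) S" "B \<in> sets borel" for S B
    using that measurable_sets[of S "normal_law a s" borel B] by (auto simp: transports_def)
  note L = transports_normal_transport[OF s r, of a b]
  show "T x = ?L x"
  proof (rule ccontr)
    assume "T x \<noteq> ?L x"
    then consider "T x < ?L x" | "?L x < T x" by linarith
    then show False
    proof cases
      case 1
      have "measure (normal_law a s) (?L -` {..?L x}) \<le> measure (normal_law a s) (T -` {..T x})"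
        using meas[OF T, of "{..T x}"] monoD[OF mono] by (intro M.finite_measure_mono) (auto simp: L_le)
      then have "measure (normal_law b r) {..?L x} \<le> measure (normal_law b r) {..T x}"
        by (simp add: tr[OF T, of "{..T x}"] tr[OF L, of "{..?L x}"])
      moreover have "measure (normal_law b r) {..?L x}
          = measure (normal_law b r) {..T x} + measure (normal_law b r) {T x<..?L x}"
        using 1 by (subst N.finite_measure_Union[symmetric]) (auto intro!: arg_cong[where f = "measure _"])
      ultimately show False using measure_normal_law_Ioc_pos[OF r 1, of b] by simp
    next
      case 2
      have "measure (normal_law a s) (?L -` {?L x..}) \<le> measure (normal_law a s) (T -` {T x..})"
        using meas[OF T, of "{T x..}"] monoD[OF mono] by (intro M.finite_measure_mono) (auto simp: L_le)
      then have "measure (normal_law b r) {?L x..} \<le> measure (normal_law b r) {T x..}"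
        by (simp add: tr[OF T, of "{T x..}"] tr[OF L, of "{?L x..}"])
      \<comment> \<open>The upper tail contains its endpoint \<open>T x\<close>, so the interval to
        be added must stop before it to remain disjoint. For lower tails the half-open interval is
        disjoint as it stands.\<close>
      moreover define z where "z = (?L x + T x) / 2"
      then have z: "?L x < z" "z < T x" using 2 by auto
      moreover have "measure (normal_law b r) {T x..} + measure (normal_law b r) {?L x<..z}
          \<le> measure (normal_law b r) {?L x..}"
        using z by (subst N.finite_measure_Union[symmetric]) (auto intro!: N.finite_measure_mono)
      ultimately show False using measure_normal_law_Ioc_pos[OF r z(1), of b] by simp
    qed
  qed
qed

text \<open>Optimality of the affine map shows that the choice operator has something to choose, so
  the chosen map is a monotone transport; pointwise uniqueness then identifies it.\<close>

lemma monotone_ot_map_normal: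
  assumes s: "0 < s" and r: "0 < r"
  shows "monotone_ot_map (normal_law a s) (normal_law b r) = normal_transport a s b r"
proof -
  let ?L = "normal_transport a s b r"
  note L = transports_normal_transport[OF s r, of a b]
  have "is_monotone_ot_map (normal_law a s) (normal_law b r) ?L"
    unfolding is_monotone_ot_map_def
  proof (intro conjI allI impI L)
    show "mono ?L" using s r by (auto simp: mono_def normal_transport_def intro!: divide_right_mono mult_left_mono)
    fix S assume "transports (normal_law a s) (normal_law b r) S"
    from transport_cost(1)[OF s r this] transport_cost(2)[OF s r L refl]
    show "(\<integral>\<^sup>+x. ennreal ((x - ?L x)\<^sup>2) \<partial>normal_law a s) \<le> (\<integral>\<^sup>+x. ennreal ((x - S x)\<^sup>2) \<partial>normal_law a s)"
      by simp
  qed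
  then have "is_monotone_ot_map (normal_law a s) (normal_law b r)
      (monotone_ot_map (normal_law a s) (normal_law b r))"
    unfolding monotone_ot_map_def
    by (rule someI[of "is_monotone_ot_map (normal_law a s) (normal_law b r)"])
  then show ?thesis
    unfolding is_monotone_ot_map_def using mono_transport_normal_unique[OF s r] by blast
qed

section \<open>Second moments of the uniform measure on the sphere\<close>

lemma sets_sphere_measure [measurable_cong]:
  "sets (sphere_measure :: (real^'n) measure) = sets (restrict_space borel (sphere 0 1))"
  by (simp add: sphere_measure_def sets_restrict_space)

lemma integrable_sphere_measure:
  fixes f :: "real^'n \<Rightarrow> 'b::{banach, second_countable_topology}"
  assumes f: "continuous_on (sphere 0 1) f"
  shows "integrable sphere_measure f"
proof -
  interpret prob_space "sphere_measure :: (real^'n) measure" by (rule prob_space_sphere_measure)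
  have "f \<in> borel_measurable (restrict_space borel (sphere 0 1))"
    by (rule borel_measurable_continuous_on_restrict[OF f])
  then have [measurable]: "f \<in> borel_measurable sphere_measure"
    by (simp cong: measurable_cong_sets add: measurable_cong_sets[OF sets_sphere_measure refl])
  have "bounded (f ` sphere 0 1)"
    by (intro compact_imp_bounded compact_continuous_image f compact_sphere)
  then obtain B where "\<And>x. x \<in> sphere 0 1 \<Longrightarrow> norm (f x) \<le> B"
    by (meson bounded_iff image_eqI)
  then show ?thesis
    by (intro integrable_const_bound[of _ B]) (auto intro!: AE_I2 simp: space_sphere_measure)
qed

lemma norm_integral_sphere_measure_le:
  fixes f :: "real^'n \<Rightarrow> 'b::{banach, second_countable_topology}"
  assumes f: "continuous_on (sphere 0 1) f" and B: "\<And>\<theta>. norm \<theta> = 1 \<Longrightarrow> norm (f \<theta>) \<le> B"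
  shows "norm (\<integral>\<theta>. f \<theta> \<partial>sphere_measure) \<le> B"
proof -
  interpret prob_space "sphere_measure :: (real^'n) measure" by (rule prob_space_sphere_measure)
  have "norm (\<integral>\<theta>. f \<theta> \<partial>sphere_measure) \<le> (\<integral>\<theta>. norm (f \<theta>) \<partial>sphere_measure)"
    by (rule integral_norm_bound)
  also have "\<dots> \<le> B"
    by (rule integral_le_const)
      (auto intro!: AE_I2 B integrable_sphere_measure continuous_on_norm f simp: space_sphere_measure)
  finally show ?thesis .
qed

lemma distr_uniform_ball_orthogonal:
  fixes U :: "real^'n^'n"
  assumes U: "orthogonal_matrix U"
  shows "distr (uniform_measure lborel (ball 0 1)) borel ((*v) U) = uniform_measure lborel (ball 0 1)"
proof (rule measure_eqI)
  fix S assume "S \<in> sets (distr (uniform_measure lborel (ball 0 1 :: (real^'n) set)) borel ((*v) U))"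
  then have S[measurable]: "S \<in> sets borel" by simp
  have V: "(*v) U -` S \<in> sets borel" using measurable_sets[OF measurable_matrix_vector_mult S, of U] by simp
  have "ball 0 1 \<inter> (*v) U -` S = (*v) U -` (ball 0 1 \<inter> S)"
    by (auto simp: norm_orthogonal_matrix[OF U])
  then have "emeasure lborel (ball 0 1 \<inter> (*v) U -` S) = emeasure (distr lborel borel ((*v) U)) (ball 0 1 \<inter> S)"
    by (simp add: emeasure_distr)
  then have "emeasure lborel (ball 0 1 \<inter> (*v) U -` S) = emeasure lborel (ball 0 1 \<inter> S)"
    by (simp only: distr_lborel_orthogonal[OF U])
  then show "emeasure (distr (uniform_measure lborel (ball 0 1)) borel ((*v) U)) S
      = emeasure (uniform_measure lborel (ball 0 1)) S"
    using V by (simp add: emeasure_distr)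
qed simp

text \<open>Pulls the integral back to the ball, whose rotation invariance is that of Lebesgue
  measure. The indicator stems from the restriction to the sphere and differs from 1 only at
  \<open>y = 0\<close>, where \<open>sgn y = 0\<close>.\<close>

lemma integral_sphere_measure:
  fixes f :: "real^'n \<Rightarrow> real"
  assumes [measurable]: "f \<in> borel_measurable borel"
  shows "(\<integral>\<theta>. f \<theta> \<partial>sphere_measure) =
    (\<integral>y. indicator (sphere 0 1) (sgn y) * f (sgn y) \<partial>uniform_measure lborel (ball 0 1))"
proof -
  have [measurable]: "(sgn :: real^'n \<Rightarrow> real^'n) \<in> borel_measurable borel" by measurable
  have [measurable]: "(sphere 0 1 :: (real^'n) set) \<in> sets borel" by (intro borel_closed closed_sphere)
  show ?thesis
    unfolding sphere_measure_def
    by (subst integral_restrict_space, simp, subst integral_distr) simp_all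
qed

text \<open>The radial projection commutes with \<open>U\<close>, so the invariance of the uniform
  law on the ball is inherited.\<close>

lemma integral_sphere_measure_orthogonal:
  fixes U :: "real^'n^'n" and f :: "real^'n \<Rightarrow> real"
  assumes U: "orthogonal_matrix U" and [measurable]: "f \<in> borel_measurable borel"
  shows "(\<integral>\<theta>. f (U *v \<theta>) \<partial>sphere_measure) = (\<integral>\<theta>. f \<theta> \<partial>sphere_measure)"
proof -
  let ?u = "uniform_measure lborel (ball 0 1 :: (real^'n) set)"
  have [measurable]: "(sgn :: real^'n \<Rightarrow> real^'n) \<in> borel_measurable borel" by measurable
  have [measurable]: "(sphere 0 1 :: (real^'n) set) \<in> sets borel" by (intro borel_closed closed_sphere)
  have sgn: "sgn (U *v y) = U *v sgn y" for y
    by (simp add: sgn_div_norm norm_orthogonal_matrix[OF U] matrix_vector_mult_scaleR)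
  have ind: "indicator (sphere 0 1) (U *v y) = (indicator (sphere 0 1) y :: real)" for y
    by (simp add: indicator_def norm_orthogonal_matrix[OF U])
  have "(\<integral>\<theta>. f \<theta> \<partial>sphere_measure) = (\<integral>y. indicator (sphere 0 1) (sgn y) * f (sgn y) \<partial>distr ?u borel ((*v) U))"
    by (simp add: integral_sphere_measure distr_uniform_ball_orthogonal[OF U])
  also have "\<dots> = (\<integral>y. indicator (sphere 0 1) (sgn y) * f (U *v sgn y) \<partial>?u)"
    by (subst integral_distr) (auto simp: sgn ind)
  finally show ?thesis by (simp add: integral_sphere_measure)
qed

lemma outer_square_nth: "outer_square v $ i $ j = v $ i * v $ j"
  by (simp add: outer_square_def)

text \<open>Symmetry determines the matrix: the reflection of one coordinate changes the sign of an
  off-diagonal entry, a rotation taking one axis to another equates two diagonal entries, and the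
  trace is the integral of the squared norm, which is 1.\<close>

lemma integral_outer_square:
  "(\<integral>\<theta>. outer_square \<theta> \<partial>sphere_measure) = (1 / real CARD('n)) *\<^sub>R (mat 1 :: real^'n^'n)"
proof -
  interpret prob_space "sphere_measure :: (real^'n) measure" by (rule prob_space_sphere_measure)
  have int: "integrable sphere_measure (outer_square :: real^'n \<Rightarrow> _)"
    unfolding outer_square_def by (intro integrable_sphere_measure continuous_intros)
  define q where "q i j = (\<integral>\<theta>. \<theta> $ i * \<theta> $ j \<partial>(sphere_measure :: (real^'n) measure))" for i j
  have comp: "(\<integral>\<theta>. outer_square \<theta> \<partial>sphere_measure) $ i $ j = q i j" for i j :: 'n
  proof -
    have "bounded_linear (\<lambda>A :: real^'n^'n. A $ i $ j)"
      by (rule bounded_linear_compose[OF bounded_linear_vec_nth bounded_linear_vec_nth])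
    from integral_bounded_linear[OF this int] show ?thesis
      by (simp add: outer_square_nth q_def)
  qed
  have off: "q i j = 0" if "i \<noteq> j" for i j
  proof -
    define V where "V = diag_mat (\<lambda>k. if k = i then - 1 else 1 :: real)"
    have "orthogonal_matrix V"
      unfolding orthogonal_matrix V_def transpose_diag_mat
      by (simp add: matrix_eq matrix_vector_mul_assoc[symmetric] diag_mat_mult_vector vec_eq_iff)
    from integral_sphere_measure_orthogonal[OF this, of "\<lambda>\<theta>. \<theta> $ i * \<theta> $ j"]
    have "- q i j = q i j" using that by (simp add: q_def V_def diag_mat_mult_vector)
    then show ?thesis by simp
  qed
  have same: "q i i = q j j" for i j
  proof -
    have "norm (axis i 1 :: real^'n) = norm (axis j 1 :: real^'n)" by (simp add: norm_axis)
    then obtain f :: "real^'n \<Rightarrow> real^'n" where f: "orthogonal_transformation f" "f (axis i 1) = axis j 1"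
      by (metis orthogonal_transformation_exists)
    define V where "V = matrix f"
    have V: "orthogonal_matrix V" "V *v x = f x" for x
      using f(1) unfolding V_def orthogonal_transformation_matrix by auto
    have "(V *v x) $ j = x $ i" for x
    proof -
      have "f x \<bullet> f (axis i 1) = x \<bullet> axis i 1"
        using f(1) unfolding orthogonal_transformation_def by blast
      then show ?thesis by (simp add: V f(2) inner_axis)
    qed
    with integral_sphere_measure_orthogonal[OF V(1), of "\<lambda>\<theta>. \<theta> $ j * \<theta> $ j"]
    show ?thesis by (simp add: q_def)
  qed
  have "(\<Sum>i\<in>UNIV. q i i) = (\<integral>\<theta>. (\<Sum>i\<in>UNIV. \<theta> $ i * \<theta> $ i) \<partial>(sphere_measure :: (real^'n) measure))"
    unfolding q_def
    by (subst Bochner_Integration.integral_sum)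
      (auto intro!: integrable_sphere_measure continuous_intros)
  also have "\<dots> = (\<integral>\<theta>. 1 \<partial>(sphere_measure :: (real^'n) measure))"
    by (intro Bochner_Integration.integral_cong)
      (simp_all add: space_sphere_measure norm_eq_1 inner_vec_def)
  also have "\<dots> = 1" by (simp add: prob_space)
  finally have sum: "(\<Sum>i\<in>UNIV. q i i) = 1" .
  have "q i i = 1 / real CARD('n)" for i
  proof -
    have "(\<Sum>j\<in>UNIV. q j j) = (\<Sum>j\<in>(UNIV::'n set). q i i)"
      by (intro sum.cong refl same)
    then show ?thesis using sum by (simp add: field_simps)
  qed
  then show ?thesis
    using off by (auto simp: vec_eq_iff comp mat_def)
qed

section \<open>The truncated field\<close>

text \<open>\<open>norm\<close> on nested vectors is the Frobenius norm, so this is Cauchy-Schwarz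
  row by row.\<close>

lemma norm_matrix_vector_mult_le: "norm (A *v x) \<le> norm A * norm x"
  for A :: "real^'n^'m"
proof -
  have "norm (A *v x) = L2_set (\<lambda>i. \<bar>A $ i \<bullet> x\<bar>) UNIV"
    by (simp add: norm_vec_def matrix_mult_dot)
  also have "\<dots> \<le> L2_set (\<lambda>i. norm x * norm (A $ i)) UNIV"
    by (intro L2_set_mono) (simp_all add: Cauchy_Schwarz_ineq2 mult.commute[of "norm x"])
  also have "\<dots> = norm x * norm A"
    by (simp add: L2_set_right_distrib[symmetric] norm_vec_def)
  finally show ?thesis by (simp add: mult.commute)
qed

lemma bounded_bilinear_matrix_mult: "bounded_bilinear ((**) :: real^'n^'m \<Rightarrow> real^'k^'n \<Rightarrow> real^'k^'m)"
  unfolding bilinear_conv_bounded_bilinear[symmetric] bilinear_def linear_iff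
  by (auto simp: matrix_matrix_mult_def vec_eq_iff sum.distrib sum_distrib_left algebra_simps)

lemmas matrix_mult_scaleR =
  bounded_bilinear.scaleR_left[OF bounded_bilinear_matrix_mult]
  bounded_bilinear.scaleR_right[OF bounded_bilinear_matrix_mult]
lemmas matrix_mult_diff_right = bounded_bilinear.diff_right[OF bounded_bilinear_matrix_mult]
lemmas matrix_mult_diff_left = bounded_bilinear.diff_left[OF bounded_bilinear_matrix_mult]

lemma bounded_linear_transpose: "bounded_linear (transpose :: real^'n^'m \<Rightarrow> _)"
  unfolding linear_conv_bounded_linear[symmetric] linear_iff
  by (auto simp: transpose_def vec_eq_iff)

lemma bounded_linear_matrix_vector_mult_left: "bounded_linear (\<lambda>A :: real^'n^'m. A *v x)"
  unfolding linear_conv_bounded_linear[symmetric] linear_iff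
  by (auto simp: matrix_vector_mult_add_rdistrib scaleR_matrix_vector_assoc)

lemma norm_transpose: "norm (transpose A) = norm A"
  for A :: "real^'n^'m"
proof -
  have "transpose A \<bullet> transpose A = A \<bullet> A"
    unfolding inner_vec_def transpose_def by (simp, rule sum.swap)
  then show ?thesis by (simp add: norm_eq_sqrt_inner)
qed

lemma norm_matrix_mult_le: "norm (A ** B) \<le> norm A * norm B"
  for A :: "real^'n^'m" and B :: "real^'k^'n"
proof -
  have "(A ** B) $ i = transpose B *v (A $ i)" for i
    by (simp add: matrix_matrix_mult_def matrix_vector_mult_def transpose_def vec_eq_iff mult.commute
        del: transpose_matrix_vector)
  then have "norm ((A ** B) $ i) \<le> norm B * norm (A $ i)" for i
    using norm_matrix_vector_mult_le[of "transpose B" "A $ i"] by (simp only: norm_transpose)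
  then have "norm (A ** B) \<le> L2_set (\<lambda>i. norm B * norm (A $ i)) UNIV"
    unfolding norm_vec_def[of "A ** B"] by (intro L2_set_mono) auto
  also have "\<dots> = norm B * norm A"
    by (simp add: L2_set_right_distrib[symmetric] norm_vec_def[of A])
  finally show ?thesis by (simp add: mult.commute)
qed

lemmas continuous_on_matrix_mult = bounded_bilinear.continuous_on[OF bounded_bilinear_matrix_mult]
lemmas has_vector_derivative_matrix_mult =
  bounded_bilinear.has_vector_derivative[OF bounded_bilinear_matrix_mult]

lemma fundamental_matrix_exists:
  fixes A :: "real \<Rightarrow> real^'n^'n"
  assumes A: "continuous_on {0..<1} A"
  shows "\<exists>X. solves_ivp (\<lambda>t X. A t ** X) X0 X"
proof (rule picard_exists)
  show "continuous_on {0..<1} (\<lambda>t. A t ** x t)" if "continuous_on {0..<1} x" for x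
    by (intro continuous_on_matrix_mult A that)
  show "continuous_on {0..<1} (\<lambda>t. norm (A t))"
    by (intro continuous_intros A)
  show "norm (A t ** u - A t ** v) \<le> norm (A t) * norm (u - v)" for t u v
    using norm_matrix_mult_le[of "A t" "u - v"] by (simp add: matrix_mult_diff_right mult_ac)
qed

text \<open>The derivative of the product cancels, so the product keeps its initial value. The
  adjoint system thus supplies the inverse of \<open>X\<close> explicitly, and bounds on
  \<open>Z\<close> become bounds on that inverse.\<close>

lemma adjoint_fundamental_matrix:
  fixes A :: "real \<Rightarrow> real^'n^'n"
  assumes X: "solves_ivp (\<lambda>t X. A t ** X) (mat 1) X"
    and Z: "solves_ivp (\<lambda>t Z. - transpose (A t) ** Z) (mat 1) Z"
    and t: "t \<in> {0..<1}"
  shows "transpose (Z t) ** X t = mat 1"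
proof (rule ode_unique_Icc[of t "\<lambda>s. transpose (Z s) ** X s" "\<lambda>_ _. 0" "\<lambda>_. mat 1" "\<lambda>_. 0"])
  show "transpose (Z 0) ** X 0 = mat 1" using X Z by (simp add: solves_ivp_def)
  fix s assume s: "s \<in> {0..t}"
  have "((\<lambda>s. transpose (Z s) ** X s) has_vector_derivative
      transpose (Z s) ** (A s ** X s) + transpose (- transpose (A s) ** Z s) ** X s) (at s within {0..t})"
    using t s by (intro has_vector_derivative_matrix_mult
        bounded_linear.has_vector_derivative[OF bounded_linear_transpose]
        solves_ivp_Icc[OF X] solves_ivp_Icc[OF Z]) auto
  moreover have "transpose (- transpose (A s) ** Z s) = - (transpose (Z s) ** A s)"
    by (simp add: matrix_transpose_mul) (simp add: transpose_def matrix_matrix_mult_def vec_eq_iff sum_negf)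
  moreover have "- (transpose (Z s) ** A s) ** X s = - (transpose (Z s) ** A s ** X s)"
    by (simp add: matrix_matrix_mult_def vec_eq_iff sum_negf)
  ultimately show "((\<lambda>s. transpose (Z s) ** X s) has_vector_derivative 0) (at s within {0..t})"
    by (simp add: matrix_mul_assoc)
qed (use t in auto)

text \<open>With \<open>A\<close> regarded as a given function of time the equation is linear in
  \<open>S\<close>, and conjugating \<open>S 0\<close> by \<open>X\<close> solves it. In the
  applications \<open>A\<close> is computed from \<open>S\<close> itself, so the formula describes
  solutions of the nonlinear equation.\<close>

lemma lyapunov_solution:
  fixes A S :: "real \<Rightarrow> real^'n^'n"
  assumes A: "continuous_on {0..<1} A"
    and X: "solves_ivp (\<lambda>t X. A t ** X) (mat 1) X"
    and S: "\<And>t. t \<in> {0..T} \<Longrightarrow>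
      (S has_vector_derivative A t ** S t + S t ** transpose (A t)) (at t within {0..T})"
    and T: "T < 1" and t: "t \<in> {0..T}"
  shows "S t = X t ** S 0 ** transpose (X t)"
proof (rule ode_unique_Icc[of T S "\<lambda>t S. A t ** S + S ** transpose (A t)" "\<lambda>t. X t ** S 0 ** transpose (X t)"
      "\<lambda>t. 2 * norm (A t)"])
  show "S 0 = X 0 ** S 0 ** transpose (X 0)" using X by (simp add: solves_ivp_def)
  have "continuous_on {0..T} A" using A T by (rule continuous_on_Ico_Icc)
  then show "continuous_on {0..T} (\<lambda>t. 2 * norm (A t))"
    by (intro continuous_intros)
  fix s assume s: "s \<in> {0..T}"
  show "((\<lambda>t. X t ** S 0 ** transpose (X t)) has_vector_derivative
     A s ** (X s ** S 0 ** transpose (X s)) + X s ** S 0 ** transpose (X s) ** transpose (A s)) (at s within {0..T})"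
  proof -
    have X': "(X has_vector_derivative A s ** X s) (at s within {0..T})"
      using solves_ivp_Icc[OF X T s] .
    have "((\<lambda>t. X t ** S 0 ** transpose (X t)) has_vector_derivative
        (X s ** S 0) ** transpose (A s ** X s) + (X s ** 0 + (A s ** X s) ** S 0) ** transpose (X s)) (at s within {0..T})"
      by (intro has_vector_derivative_matrix_mult X' has_vector_derivative_const
          bounded_linear.has_vector_derivative[OF bounded_linear_transpose])
    then show ?thesis
      by (simp add: matrix_transpose_mul matrix_mul_assoc add.commute)
  qed
  define D where "D = S s - X s ** S 0 ** transpose (X s)"
  have "A s ** S s + S s ** transpose (A s) -
      (A s ** (X s ** S 0 ** transpose (X s)) + X s ** S 0 ** transpose (X s) ** transpose (A s))
      = A s ** D + D ** transpose (A s)"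
    by (simp add: D_def matrix_mult_diff_right matrix_mult_diff_left)
  moreover have "norm (A s ** D + D ** transpose (A s))
      \<le> 2 * norm (A s) * norm D"
    using norm_triangle_ineq[of "A s ** D" "D ** transpose (A s)"]
      norm_matrix_mult_le[of "A s" D] norm_matrix_mult_le[of D "transpose (A s)"]
    by (simp add: norm_transpose algebra_simps)
  ultimately show "norm (A s ** S s + S s ** transpose (A s) -
      (A s ** (X s ** S 0 ** transpose (X s)) + X s ** S 0 ** transpose (X s) ** transpose (A s)))
      \<le> 2 * norm (A s) *
        norm (S s - X s ** S 0 ** transpose (X s))"
    by (simp add: D_def)
qed (use S t in auto)

lemma norm_outer_square: "norm (outer_square v) = norm v * norm v"
proof -
  have "norm (outer_square v $ i) = norm v * norm (v $ i)" for i
  proof -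
    have "outer_square v $ i = v $ i *\<^sub>R v" by (simp add: outer_square_def vec_eq_iff)
    then show ?thesis by simp
  qed
  then show ?thesis
    by (subst norm_vec_def) (simp add: L2_set_right_distrib[symmetric] norm_vec_def[of v])
qed

lemma outer_square_mult_vector: "outer_square v *v x = (v \<bullet> x) *\<^sub>R v"
  by (simp add: outer_square_def matrix_vector_mult_def vec_eq_iff inner_vec_def sum_distrib_left mult_ac)

lemma transpose_outer_square: "transpose (outer_square v) = outer_square v"
  by (simp add: outer_square_def transpose_def vec_eq_iff)

lemma continuous_on_outer_square: "continuous_on X outer_square"
  unfolding outer_square_def by (intro continuous_intros)

lemma continuous_on_quadratic_form: "continuous_on X (\<lambda>\<theta>. \<theta> \<bullet> (A *v \<theta>))"
  for A :: "real^'n^'n"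
  by (intro continuous_intros linear_continuous_on matrix_vector_mul_bounded_linear)

lemma quadratic_form_le: "\<bar>\<theta> \<bullet> (A *v \<theta>)\<bar> \<le> norm A" if "norm \<theta> = 1"
  for A :: "real^'n^'n"
  using Cauchy_Schwarz_ineq2[of \<theta> "A *v \<theta>"] norm_matrix_vector_mult_le[of A \<theta>] that by simp

text \<open>Cutting the denominator of \<^term>\<open>alpha\<close> off at \<open>\<epsilon>\<close> makes \<^term>\<open>H_mat\<close> globally Lipschitz.\<close>

definition trunc_alpha :: "real \<Rightarrow> real^'n^'n \<Rightarrow> real^'n^'n \<Rightarrow> real^'n \<Rightarrow> real" where
  "trunc_alpha \<epsilon> \<Sigma>1 S \<theta> = sqrt (\<theta> \<bullet> (\<Sigma>1 *v \<theta>)) / sqrt (max \<epsilon> (\<theta> \<bullet> (S *v \<theta>)))"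

definition trunc_G :: "real \<Rightarrow> real^'n^'n \<Rightarrow> real^'n^'n \<Rightarrow> real^'n^'n" where
  "trunc_G \<epsilon> \<Sigma>1 S = (\<integral>\<theta>. trunc_alpha \<epsilon> \<Sigma>1 S \<theta> *\<^sub>R outer_square \<theta> \<partial>sphere_measure)"

definition trunc_H :: "real \<Rightarrow> real^'n^'n \<Rightarrow> real^'n^'n \<Rightarrow> real^'n^'n" where
  "trunc_H \<epsilon> \<Sigma>1 S = trunc_G \<epsilon> \<Sigma>1 S - (1 / real CARD('n)) *\<^sub>R mat 1"

locale truncation =
  fixes \<epsilon> :: real and \<Sigma>1 :: "real^'n^'n"
  assumes \<epsilon>: "0 < \<epsilon>" and \<Sigma>1: "pos_def \<Sigma>1"
begin

lemma \<Sigma>1_form_nonneg: "0 \<le> \<theta> \<bullet> (\<Sigma>1 *v \<theta>)"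
  using \<Sigma>1 unfolding pos_def_def by (cases "\<theta> = 0") (auto intro: less_imp_le)

lemma trunc_alpha_nonneg: "0 \<le> trunc_alpha \<epsilon> \<Sigma>1 S \<theta>"
  unfolding trunc_alpha_def using \<epsilon> \<Sigma>1_form_nonneg by (intro divide_nonneg_nonneg) auto

lemma trunc_alpha_le: "norm \<theta> = 1 \<Longrightarrow> trunc_alpha \<epsilon> \<Sigma>1 S \<theta> \<le> sqrt (norm \<Sigma>1) / sqrt \<epsilon>"
  unfolding trunc_alpha_def
  using \<epsilon> \<Sigma>1_form_nonneg quadratic_form_le[of \<theta> \<Sigma>1]
  by (intro frac_le) auto

text \<open>The difference of \<open>1 / p\<close> and \<open>1 / q\<close> is that of the squares
  divided by \<open>p * q * (p + q)\<close>. The squares are the cut-off forms, Lipschitz in the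
  matrix because \<open>max\<close> is nonexpansive, and the denominator is at least
  \<open>\<epsilon> * sqrt \<epsilon>\<close> since both roots are at least
  \<open>sqrt \<epsilon>\<close>.\<close>

lemma trunc_alpha_lipschitz:
  assumes "norm \<theta> = 1"
  shows "\<bar>trunc_alpha \<epsilon> \<Sigma>1 S \<theta> - trunc_alpha \<epsilon> \<Sigma>1 S' \<theta>\<bar> \<le> sqrt (norm \<Sigma>1) / (\<epsilon> * sqrt \<epsilon>) * norm (S - S')"
proof -
  define p q where "p = sqrt (max \<epsilon> (\<theta> \<bullet> (S *v \<theta>)))" and "q = sqrt (max \<epsilon> (\<theta> \<bullet> (S' *v \<theta>)))"
  have pq: "sqrt \<epsilon> \<le> p" "sqrt \<epsilon> \<le> q" "0 < sqrt \<epsilon>" using \<epsilon> by (auto simp: p_def q_def)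
  have pos: "0 < p" "0 < q" using pq by linarith+
  have e: "\<epsilon> * sqrt \<epsilon> \<le> p * q * (p + q)"
  proof -
    have "\<epsilon> = sqrt \<epsilon> * sqrt \<epsilon>" using \<epsilon> by simp
    also have "\<dots> \<le> p * q" using pq by (intro mult_mono) linarith+
    finally have "\<epsilon> \<le> p * q" .
    then show ?thesis using pq \<epsilon> by (intro mult_mono) linarith+
  qed
  have "\<theta> \<bullet> (S *v \<theta>) - \<theta> \<bullet> (S' *v \<theta>) = \<theta> \<bullet> ((S - S') *v \<theta>)"
    by (simp add: matrix_vector_mult_diff_rdistrib inner_diff_right)
  then have "\<bar>\<theta> \<bullet> (S *v \<theta>) - \<theta> \<bullet> (S' *v \<theta>)\<bar> \<le> norm (S - S')"
    using quadratic_form_le[OF assms, of "S - S'"] by simp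
  moreover have "p\<^sup>2 = max \<epsilon> (\<theta> \<bullet> (S *v \<theta>))" "q\<^sup>2 = max \<epsilon> (\<theta> \<bullet> (S' *v \<theta>))"
    using \<epsilon> by (simp_all add: p_def q_def)
  ultimately have d: "\<bar>q\<^sup>2 - p\<^sup>2\<bar> \<le> norm (S - S')" by (auto simp: max_def)
  have "1 / p - 1 / q = (q\<^sup>2 - p\<^sup>2) / (p * q * (p + q))"
    using pos by (simp add: divide_simps power2_eq_square) (simp add: algebra_simps)
  then have "\<bar>1 / p - 1 / q\<bar> = \<bar>q\<^sup>2 - p\<^sup>2\<bar> / (p * q * (p + q))"
    using pos by (simp add: abs_mult)
  also have "\<dots> \<le> norm (S - S') / (\<epsilon> * sqrt \<epsilon>)"
    using d e \<epsilon> by (intro frac_le) auto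
  finally have "\<bar>1 / p - 1 / q\<bar> \<le> norm (S - S') / (\<epsilon> * sqrt \<epsilon>)" .
  moreover have "sqrt (\<theta> \<bullet> (\<Sigma>1 *v \<theta>)) \<le> sqrt (norm \<Sigma>1)"
    using quadratic_form_le[OF assms, of \<Sigma>1] by simp
  ultimately have "sqrt (\<theta> \<bullet> (\<Sigma>1 *v \<theta>)) * \<bar>1 / p - 1 / q\<bar>
      \<le> sqrt (norm \<Sigma>1) * (norm (S - S') / (\<epsilon> * sqrt \<epsilon>))"
    by (intro mult_mono) auto
  moreover have "\<bar>trunc_alpha \<epsilon> \<Sigma>1 S \<theta> - trunc_alpha \<epsilon> \<Sigma>1 S' \<theta>\<bar>
      = \<bar>sqrt (\<theta> \<bullet> (\<Sigma>1 *v \<theta>)) * (1 / p - 1 / q)\<bar>"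
    unfolding trunc_alpha_def p_def[symmetric] q_def[symmetric] by (simp add: right_diff_distrib)
  ultimately show ?thesis using \<Sigma>1_form_nonneg[of \<theta>] by (simp add: abs_mult)
qed

lemma continuous_on_trunc_alpha: "continuous_on X (trunc_alpha \<epsilon> \<Sigma>1 S)"
proof -
  have "sqrt (max \<epsilon> (\<theta> \<bullet> (S *v \<theta>))) \<noteq> 0" for \<theta> using \<epsilon> by auto
  then show ?thesis
    unfolding trunc_alpha_def[abs_def]
    by (intro continuous_on_divide continuous_on_real_sqrt continuous_on_max continuous_on_const
        continuous_on_quadratic_form) auto
qed

lemma continuous_on_trunc_integrand:
  "continuous_on X (\<lambda>\<theta>. trunc_alpha \<epsilon> \<Sigma>1 S \<theta> *\<^sub>R outer_square \<theta>)"
  by (intro continuous_on_scaleR continuous_on_trunc_alpha continuous_on_outer_square)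

lemma norm_trunc_G_le: "norm (trunc_G \<epsilon> \<Sigma>1 S) \<le> sqrt (norm \<Sigma>1) / sqrt \<epsilon>"
  unfolding trunc_G_def
  by (rule norm_integral_sphere_measure_le[OF continuous_on_trunc_integrand])
    (simp add: norm_outer_square trunc_alpha_nonneg trunc_alpha_le)

lemma trunc_G_lipschitz:
  "norm (trunc_G \<epsilon> \<Sigma>1 S - trunc_G \<epsilon> \<Sigma>1 S') \<le> sqrt (norm \<Sigma>1) / (\<epsilon> * sqrt \<epsilon>) * norm (S - S')"
proof -
  have "trunc_G \<epsilon> \<Sigma>1 S - trunc_G \<epsilon> \<Sigma>1 S' = (\<integral>\<theta>. trunc_alpha \<epsilon> \<Sigma>1 S \<theta> *\<^sub>R outer_square \<theta>
      - trunc_alpha \<epsilon> \<Sigma>1 S' \<theta> *\<^sub>R outer_square \<theta> \<partial>sphere_measure)"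
    unfolding trunc_G_def
    by (rule Bochner_Integration.integral_diff[symmetric])
      (intro integrable_sphere_measure continuous_on_trunc_integrand)+
  also have "norm \<dots> \<le> sqrt (norm \<Sigma>1) / (\<epsilon> * sqrt \<epsilon>) * norm (S - S')"
  proof (rule norm_integral_sphere_measure_le)
    fix \<theta> :: "real^'n" assume \<theta>: "norm \<theta> = 1"
    have "trunc_alpha \<epsilon> \<Sigma>1 S \<theta> *\<^sub>R outer_square \<theta> - trunc_alpha \<epsilon> \<Sigma>1 S' \<theta> *\<^sub>R outer_square \<theta>
      = (trunc_alpha \<epsilon> \<Sigma>1 S \<theta> - trunc_alpha \<epsilon> \<Sigma>1 S' \<theta>) *\<^sub>R outer_square \<theta>"
      by (simp add: scaleR_diff_left)
    then show "norm (trunc_alpha \<epsilon> \<Sigma>1 S \<theta> *\<^sub>R outer_square \<theta> - trunc_alpha \<epsilon> \<Sigma>1 S' \<theta> *\<^sub>R outer_square \<theta>)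
      \<le> sqrt (norm \<Sigma>1) / (\<epsilon> * sqrt \<epsilon>) * norm (S - S')"
      using trunc_alpha_lipschitz[OF \<theta>, of S S'] \<theta> by (simp add: norm_outer_square)
  qed (intro continuous_on_diff continuous_on_trunc_integrand)
  finally show ?thesis .
qed

lemma transpose_trunc_G: "transpose (trunc_G \<epsilon> \<Sigma>1 S) = trunc_G \<epsilon> \<Sigma>1 S"
  using integral_bounded_linear[OF bounded_linear_transpose
      integrable_sphere_measure[OF continuous_on_trunc_integrand], of S]
  by (simp add: trunc_G_def transpose_scalar transpose_outer_square)

lemma trunc_G_psd: "0 \<le> x \<bullet> (trunc_G \<epsilon> \<Sigma>1 S *v x)"
proof -
  have "bounded_linear (\<lambda>A :: real^'n^'n. x \<bullet> (A *v x))"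
    by (rule bounded_linear_compose[OF bounded_linear_inner_right bounded_linear_matrix_vector_mult_left])
  from integral_bounded_linear[OF this integrable_sphere_measure[OF continuous_on_trunc_integrand], of S]
  have "x \<bullet> (trunc_G \<epsilon> \<Sigma>1 S *v x) = (\<integral>\<theta>. trunc_alpha \<epsilon> \<Sigma>1 S \<theta> * (\<theta> \<bullet> x)\<^sup>2 \<partial>sphere_measure)"
    by (simp add: trunc_G_def scaleR_matrix_vector_assoc[symmetric] outer_square_mult_vector inner_commute mult.assoc power2_eq_square)
  also have "\<dots> \<ge> 0"
    by (intro Bochner_Integration.integral_nonneg mult_nonneg_nonneg trunc_alpha_nonneg zero_le_power2)
  finally show ?thesis .
qed

lemma transpose_trunc_H: "transpose (trunc_H \<epsilon> \<Sigma>1 S) = trunc_H \<epsilon> \<Sigma>1 S"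
  unfolding trunc_H_def
  by (simp add: linear_diff[OF bounded_linear.linear[OF bounded_linear_transpose]] transpose_trunc_G transpose_scalar)

text \<open>The constant involves neither \<open>\<epsilon>\<close> nor \<open>S\<close>: this
  uniformity lets the cutoff be fixed before any solution is known.\<close>

lemma trunc_H_ge: "- (1 / real CARD('n)) * (norm x)\<^sup>2 \<le> x \<bullet> (trunc_H \<epsilon> \<Sigma>1 S *v x)"
  using trunc_G_psd[of x S]
  by (simp add: trunc_H_def matrix_vector_mult_diff_rdistrib inner_diff_right
      scaleR_matrix_vector_assoc[symmetric] power2_norm_eq_inner)

lemma trunc_H_lipschitz:
  "norm (trunc_H \<epsilon> \<Sigma>1 S - trunc_H \<epsilon> \<Sigma>1 S') \<le> sqrt (norm \<Sigma>1) / (\<epsilon> * sqrt \<epsilon>) * norm (S - S')"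
  using trunc_G_lipschitz by (simp add: trunc_H_def)

definition H_bound :: real where
  "H_bound = sqrt (norm \<Sigma>1) / sqrt \<epsilon> + norm ((1 / real CARD('n)) *\<^sub>R mat 1 :: real^'n^'n)"

lemma norm_trunc_H_le: "norm (trunc_H \<epsilon> \<Sigma>1 S) \<le> H_bound"
  unfolding trunc_H_def H_bound_def
  using norm_triangle_ineq4[of "trunc_G \<epsilon> \<Sigma>1 S" "(1 / real CARD('n)) *\<^sub>R mat 1"] norm_trunc_G_le[of S]
  by linarith

lemma H_bound_nonneg: "0 \<le> H_bound"
  using norm_trunc_H_le norm_ge_zero order_trans by blast

lemma H_mat_eq_trunc_H:
  assumes "\<And>\<theta>. norm \<theta> = 1 \<Longrightarrow> \<epsilon> \<le> \<theta> \<bullet> (S *v \<theta>)"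
  shows "H_mat \<Sigma>1 S = trunc_H \<epsilon> \<Sigma>1 S"
proof -
  have "(\<integral>\<theta>. alpha \<Sigma>1 S \<theta> *\<^sub>R outer_square \<theta> \<partial>sphere_measure) = trunc_G \<epsilon> \<Sigma>1 S"
    unfolding trunc_G_def
    by (intro Bochner_Integration.integral_cong)
      (simp_all add: space_sphere_measure alpha_def trunc_alpha_def real_sqrt_divide max_absorb2 assms)
  then show ?thesis by (simp add: H_mat_def trunc_H_def)
qed

text \<open>The nearest-point retraction onto a ball of matrices, being nonexpansive, makes the
  product of \<open>H\<close> and \<open>\<Sigma>\<close> globally Lipschitz.\<close>

definition clip :: "real \<Rightarrow> real^'n^'n \<Rightarrow> real^'n^'n" where
  "clip R = closest_point (cball 0 R)"

lemma clip_lipschitz: "0 \<le> R \<Longrightarrow> norm (clip R S - clip R S') \<le> norm (S - S')"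
  unfolding clip_def using closest_point_lipschitz[of "cball 0 R" S S'] by (simp add: dist_norm)

lemma norm_clip_le: "0 \<le> R \<Longrightarrow> norm (clip R S) \<le> R"
  unfolding clip_def using closest_point_in_set[of "cball 0 R" S] by simp

lemma clip_id: "norm S \<le> R \<Longrightarrow> clip R S = S"
  unfolding clip_def by (rule closest_point_self) simp

lemma norm_clip_le_norm: "0 \<le> R \<Longrightarrow> norm (clip R S) \<le> norm S"
  using clip_lipschitz[of R S 0] clip_id[of 0 R] by simp

text \<open>Only the factor \<open>S\<close> is clipped, since \<open>trunc_H\<close> is already
  bounded and Lipschitz on all matrices.\<close>

definition field :: "real \<Rightarrow> real^'n^'n \<Rightarrow> real^'n^'n" where
  "field R S = trunc_H \<epsilon> \<Sigma>1 S ** clip R S + clip R S ** trunc_H \<epsilon> \<Sigma>1 S"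

definition field_lip :: "real \<Rightarrow> real" where
  "field_lip R = 2 * (sqrt (norm \<Sigma>1) / (\<epsilon> * sqrt \<epsilon>) * R + H_bound)"

lemma field_lipschitz:
  assumes R: "0 \<le> R"
  shows "norm (field R S - field R S') \<le> field_lip R * norm (S - S')"
proof -
  let ?L = "sqrt (norm \<Sigma>1) / (\<epsilon> * sqrt \<epsilon>)"
  let ?H = "trunc_H \<epsilon> \<Sigma>1 S" and ?H' = "trunc_H \<epsilon> \<Sigma>1 S'" and ?Q = "clip R S" and ?Q' = "clip R S'"
  have eq: "field R S - field R S' = (?H - ?H') ** ?Q + ?H' ** (?Q - ?Q') + (?Q - ?Q') ** ?H' + ?Q ** (?H - ?H')"
    by (simp add: field_def matrix_mult_diff_right matrix_mult_diff_left)
  have H: "norm (?H - ?H') * norm ?Q \<le> (?L * norm (S - S')) * R"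
    using R \<epsilon> trunc_H_lipschitz[of S S'] norm_clip_le[OF R, of S]
    by (intro mult_mono mult_nonneg_nonneg) auto
  have Q: "norm ?H' * norm (?Q - ?Q') \<le> H_bound * norm (S - S')"
    using R norm_trunc_H_le[of S'] clip_lipschitz[OF R, of S S']
    by (intro mult_mono mult_nonneg_nonneg H_bound_nonneg) auto
  have "norm (field R S - field R S')
      \<le> norm ((?H - ?H') ** ?Q) + norm (?H' ** (?Q - ?Q')) + norm ((?Q - ?Q') ** ?H') + norm (?Q ** (?H - ?H'))"
    unfolding eq by (intro norm_triangle_le add_mono order_refl)
  also have "\<dots> \<le> (?L * norm (S - S')) * R + H_bound * norm (S - S')
      + H_bound * norm (S - S') + (?L * norm (S - S')) * R"
    using norm_matrix_mult_le[of "?H - ?H'" ?Q] norm_matrix_mult_le[of ?H' "?Q - ?Q'"]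
      norm_matrix_mult_le[of "?Q - ?Q'" ?H'] norm_matrix_mult_le[of ?Q "?H - ?H'"] H Q
    by (intro add_mono) (auto simp: mult_ac)
  also have "\<dots> = field_lip R * norm (S - S')"
    by (simp add: field_lip_def algebra_simps)
  finally show ?thesis .
qed

text \<open>Clipping does not increase the norm, so the bound is free of \<open>R\<close>, and
  \<open>R\<close> can afterwards be taken to be the Gronwall bound that it yields.\<close>

lemma norm_field_le:
  assumes R: "0 \<le> R"
  shows "norm (field R S) \<le> 2 * H_bound * norm S"
proof -
  let ?H = "trunc_H \<epsilon> \<Sigma>1 S" and ?Q = "clip R S"
  have H: "norm ?H * norm ?Q \<le> H_bound * norm S"
    using norm_trunc_H_le[of S] norm_clip_le_norm[OF R, of S]
    by (intro mult_mono mult_nonneg_nonneg H_bound_nonneg) auto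
  have "norm (field R S) \<le> norm (?H ** ?Q) + norm (?Q ** ?H)"
    unfolding field_def by (rule norm_triangle_ineq)
  also have "\<dots> \<le> H_bound * norm S + H_bound * norm S"
    using norm_matrix_mult_le[of ?H ?Q] norm_matrix_mult_le[of ?Q ?H] H
    by (intro add_mono) (auto simp: mult_ac)
  finally show ?thesis by (simp add: mult_ac)
qed

end

section \<open>The covariance equation\<close>

lemma bounded_bilinear_matrix_vector_mult: "bounded_bilinear ((*v) :: real^'n^'m \<Rightarrow> real^'n \<Rightarrow> real^'m)"
  unfolding bilinear_conv_bounded_bilinear[symmetric] bilinear_def linear_iff
  by (auto simp: matrix_vector_mult_def vec_eq_iff sum.distrib sum_distrib_left algebra_simps)

text \<open>The form is continuous and positive on a compact set of pairs, so its minimum there is a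
  positive constant. It supplies a cutoff that is invisible along a path already known to be
  positive definite.\<close>

lemma pos_def_path_lower_bound:
  fixes S :: "real \<Rightarrow> real^'n^'n"
  assumes T: "0 \<le> T" and S: "continuous_on {0..T} S" and pd: "\<And>t. t \<in> {0..T} \<Longrightarrow> pos_def (S t)"
  obtains c where "0 < c" "\<And>t \<theta>. t \<in> {0..T} \<Longrightarrow> norm \<theta> = 1 \<Longrightarrow> c \<le> \<theta> \<bullet> (S t *v \<theta>)"
proof -
  let ?K = "{0..T} \<times> (sphere 0 1 :: (real^'n) set)" and ?q = "\<lambda>p. snd p \<bullet> (S (fst p) *v snd p)"
  have "compact ?K" by (intro compact_Times compact_Icc compact_sphere)
  moreover have "(0, axis undefined 1) \<in> ?K" using T by (simp add: norm_axis)
  then have "?K \<noteq> {}" by fast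
  moreover have "continuous_on ?K (\<lambda>p. S (fst p))"
    by (rule continuous_on_compose2[OF S]) (auto intro!: continuous_intros)
  then have "continuous_on ?K ?q"
    by (intro continuous_on_inner bounded_bilinear.continuous_on[OF bounded_bilinear_matrix_vector_mult]
        continuous_on_snd continuous_on_id)
  ultimately obtain p where p: "p \<in> ?K" "\<And>p'. p' \<in> ?K \<Longrightarrow> ?q p \<le> ?q p'"
    using continuous_attains_inf[of ?K ?q] by blast
  have n: "norm (snd p) = 1" using p(1) by auto
  have "snd p \<noteq> 0"
  proof
    assume "snd p = 0"
    then show False using n by simp
  qed
  then have "0 < ?q p" using pd[of "fst p"] p(1) unfolding pos_def_def by auto
  moreover have "?q p \<le> \<theta> \<bullet> (S t *v \<theta>)" if "t \<in> {0..T}" "norm \<theta> = 1" for t \<theta>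
    using p(2)[of "(t, \<theta>)"] that by simp
  ultimately show thesis using that by blast
qed

lemma pos_def_lower_bound:
  fixes A :: "real^'n^'n"
  assumes "pos_def A"
  obtains c where "0 < c" "\<And>x. c * (norm x)\<^sup>2 \<le> x \<bullet> (A *v x)"
proof -
  \<comment> \<open>The one-point interval \<open>{0..0}\<close> specialises the statement about
    paths to a single matrix.\<close>
  obtain c where c0: "0 < c" "\<And>(t::real) \<theta>. t \<in> {0..0} \<Longrightarrow> norm \<theta> = 1 \<Longrightarrow> c \<le> \<theta> \<bullet> (A *v \<theta>)"
    by (rule pos_def_path_lower_bound[of 0 "\<lambda>_. A"]) (use assms in auto)
  note c = c0(1) c0(2)[of 0, simplified]
  have "c * (norm x)\<^sup>2 \<le> x \<bullet> (A *v x)" for x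
  proof (cases "x = 0")
    case False
    then have "c \<le> sgn x \<bullet> (A *v sgn x)" by (intro c(2)) (simp add: norm_sgn)
    then have "c * (norm x)\<^sup>2 \<le> (sgn x \<bullet> (A *v sgn x)) * (norm x)\<^sup>2" by (rule mult_right_mono) simp
    also have "\<dots> = x \<bullet> (A *v x)"
      using False by (simp add: sgn_div_norm matrix_vector_mult_scaleR power2_eq_square field_simps)
    finally show ?thesis .
  qed simp
  then show thesis using that c(1) by blast
qed

abbreviation covariance_rhs ::
    "(real \<Rightarrow> real) \<Rightarrow> real^'n^'n \<Rightarrow> real \<Rightarrow> real^'n^'n \<Rightarrow> real^'n^'n" where
  "covariance_rhs lam \<Sigma>1 t S \<equiv> K_mat lam \<Sigma>1 t S ** S + S ** transpose (K_mat lam \<Sigma>1 t S)"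

context truncation
begin

lemma covariance_rhs_eq_field:
  assumes "\<And>\<theta>. norm \<theta> = 1 \<Longrightarrow> \<epsilon> \<le> \<theta> \<bullet> (S *v \<theta>)" "norm S \<le> R"
  shows "covariance_rhs lam \<Sigma>1 t S = lam t *\<^sub>R field R S"
  using H_mat_eq_trunc_H[OF assms(1)] clip_id[OF assms(2)]
  by (simp add: K_mat_def field_def transpose_scalar transpose_trunc_H matrix_mult_scaleR
      scaleR_add_right)

lemma scaled_field_lipschitz:
  assumes "0 \<le> a" "0 \<le> R"
  shows "norm (a *\<^sub>R field R S - a *\<^sub>R field R S') \<le> a * field_lip R * norm (S - S')"
  using mult_left_mono[OF field_lipschitz[OF assms(2), of S S'] assms(1)] assms(1)
  by (simp add: scaleR_diff_right[symmetric] mult.assoc)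

lemma continuous_on_trunc_H: "continuous_on UNIV (trunc_H \<epsilon> \<Sigma>1)"
proof (rule lipschitz_on_continuous_on)
  show "(sqrt (norm \<Sigma>1) / (\<epsilon> * sqrt \<epsilon>))-lipschitz_on UNIV (trunc_H \<epsilon> \<Sigma>1)"
    using \<epsilon> trunc_H_lipschitz by (intro lipschitz_onI) (auto simp: dist_norm)
qed

lemma continuous_on_field:
  assumes R: "0 \<le> R"
  shows "continuous_on UNIV (field R)"
proof (rule lipschitz_on_continuous_on)
  show "(field_lip R)-lipschitz_on UNIV (field R)"
    using \<epsilon> R H_bound_nonneg field_lipschitz[OF R]
    by (intro lipschitz_onI) (auto simp: dist_norm field_lip_def)
qed

text \<open>With \<open>\<Sigma> = X \<Sigma>0 X\<^sup>T\<close> and \<open>Z = X\<^sup>-\<^sup>T\<close>, the bound \<open>H \<ge> - I / n\<close> controls the growth of \<open>Z\<close>,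
  whence \<open>\<Sigma>\<close> stays above the cutoff and solves the original equation.\<close>

lemma trunc_covariance_solution:
  fixes \<Sigma>0 :: "real^'n^'n"
  assumes lam: "continuous_on {0..<1} lam" "\<And>t. t \<in> {0..<1} \<Longrightarrow> 0 \<le> lam t"
    and \<Sigma>0: "pos_def \<Sigma>0" and c: "0 < c" "\<And>x. c * (norm x)\<^sup>2 \<le> x \<bullet> (\<Sigma>0 *v x)"
    and T: "0 \<le> T" "T < 1"
    and \<epsilon>_le: "\<epsilon> \<le> c * exp (- (2 / real CARD('n)) * integral {0..T} lam)"
  shows "\<exists>S. S 0 = \<Sigma>0 \<and> (\<forall>t\<in>{0..T}. pos_def (S t) \<and>
    (S has_vector_derivative covariance_rhs lam \<Sigma>1 t (S t)) (at t within {0..T}))"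
proof -
  have lamT: "continuous_on {0..T} lam" by (rule continuous_on_Ico_Icc[OF lam(1) T(2)])
  have lam0: "0 \<le> lam t" if "t \<in> {0..T}" for t using lam(2)[of t] that T by auto
  have int_mono: "integral {0..t} lam \<le> integral {0..T} lam" if t: "t \<in> {0..T}" for t
    using t lamT by (intro integral_subset_le integrable_continuous_interval)
      (auto intro: continuous_on_subset simp: lam0)
  \<comment> \<open>The Gronwall bound at \<open>T\<close> for the growth rate
    \<open>lam * (2 * H_bound)\<close>. It holds for the clipped equation, so \<open>clip R\<close>
    turns out to be the identity along \<open>S\<close>.\<close>
  define R where "R = norm \<Sigma>0 * exp (integral {0..T} lam * (2 * H_bound))"
  have R: "0 \<le> R" by (simp add: R_def)
  have "\<exists>S. solves_ivp (\<lambda>t S. lam t *\<^sub>R field R S) \<Sigma>0 S"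
  proof (rule picard_exists)
    show "continuous_on {0..<1} (\<lambda>t. lam t *\<^sub>R field R (x t))" if "continuous_on {0..<1} x" for x
      by (intro continuous_on_scaleR lam continuous_on_compose2[OF continuous_on_field[OF R] that]) auto
    show "continuous_on {0..<1} (\<lambda>t. lam t * field_lip R)" by (intro continuous_intros lam)
  qed (use R lam in \<open>auto intro: scaled_field_lipschitz\<close>)
  then obtain S where S: "solves_ivp (\<lambda>t S. lam t *\<^sub>R field R S) \<Sigma>0 S" by blast
  have S0: "S 0 = \<Sigma>0" using S by (simp add: solves_ivp_def)
  note S' = solves_ivp_Icc[OF S T(2)]
  have normS: "norm (S t) \<le> R" if t: "t \<in> {0..T}" for t
  proof -
    have "norm (S t) \<le> norm (S 0) * exp (integral {0..t} (\<lambda>t. lam t * (2 * H_bound)))"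
    proof (rule gronwall_norm[OF S' _ _ t])
      show "continuous_on {0..T} (\<lambda>t. lam t * (2 * H_bound))" by (intro continuous_intros lamT)
      fix s assume s: "s \<in> {0..T}"
      have "S s \<bullet> (lam s *\<^sub>R field R (S s)) \<le> norm (S s) * (lam s * norm (field R (S s)))"
        using norm_cauchy_schwarz[of "S s" "lam s *\<^sub>R field R (S s)"] lam0[OF s] by simp
      also have "\<dots> \<le> norm (S s) * (lam s * (2 * H_bound * norm (S s)))"
        using norm_field_le[OF R, of "S s"] lam0[OF s] by (intro mult_left_mono) auto
      finally show "S s \<bullet> (lam s *\<^sub>R field R (S s)) \<le> lam s * (2 * H_bound) * (norm (S s))\<^sup>2"
        by (simp add: power2_eq_square mult_ac)
    qed
    also have "integral {0..t} (\<lambda>t. lam t * (2 * H_bound)) = integral {0..t} lam * (2 * H_bound)"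
      by (rule integral_mult_left)
    also have "norm (S 0) * exp (integral {0..t} lam * (2 * H_bound)) \<le> R"
      unfolding S0 R_def using int_mono[OF t] H_bound_nonneg
      by (intro mult_left_mono) (auto intro!: mult_right_mono)
    finally show ?thesis .
  qed
  \<comment> \<open>Freezing the coefficient along \<open>S\<close> gives a linear equation and
    access to \<open>X\<close> and \<open>Z\<close>.\<close>
  define A where "A t = lam t *\<^sub>R trunc_H \<epsilon> \<Sigma>1 (S t)" for t
  have A: "continuous_on {0..<1} A"
    unfolding A_def
    by (intro continuous_on_scaleR lam solves_ivp_continuous_on[OF S]
        continuous_on_compose2[OF continuous_on_trunc_H]) auto
  have tA: "transpose (A t) = A t" for t by (simp add: A_def transpose_scalar transpose_trunc_H)
  obtain X where X: "solves_ivp (\<lambda>t X. A t ** X) (mat 1) X" using fundamental_matrix_exists[OF A] by blast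
  have "continuous_on {0..<1} (\<lambda>t. - transpose (A t))" unfolding tA by (intro continuous_intros A)
  then obtain Z where Z: "solves_ivp (\<lambda>t Z. - transpose (A t) ** Z) (mat 1) Z"
    using fundamental_matrix_exists by blast
  have ZX: "transpose (Z t) ** X t = mat 1" if "t \<in> {0..T}" for t
    using adjoint_fundamental_matrix[OF X Z, of t] that T by auto
  have SX: "S t = X t ** \<Sigma>0 ** transpose (X t)" if t: "t \<in> {0..T}" for t
    unfolding S0[symmetric]
  proof (rule lyapunov_solution[OF A X _ T(2) t])
    fix s assume s: "s \<in> {0..T}"
    have "A s ** S s + S s ** transpose (A s) = lam s *\<^sub>R field R (S s)"
      unfolding tA field_def clip_id[OF normS[OF s]]
      by (simp add: A_def matrix_mult_scaleR scaleR_add_right)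
    then show "(S has_vector_derivative A s ** S s + S s ** transpose (A s)) (at s within {0..T})"
      using S'[OF s] by simp
  qed
  \<comment> \<open>The equation of \<open>Z\<close> carries the coefficient with a minus sign, so
    the lower bound \<open>trunc_H_ge\<close>, multiplied by the nonnegative \<open>lam\<close>,
    limits growth to the rate \<open>lam / n\<close>.\<close>
  have Z_bound: "norm (Z t *v v) \<le> norm v * exp (integral {0..T} lam * (1 / real CARD('n)))"
    if t: "t \<in> {0..T}" for t v
  proof -
    have "norm (Z t *v v) \<le> norm (Z 0 *v v) * exp (integral {0..t} (\<lambda>t. lam t * (1 / real CARD('n))))"
    proof (rule gronwall_norm[OF _ _ _ t])
      show "continuous_on {0..T} (\<lambda>t. lam t * (1 / real CARD('n)))" by (intro continuous_intros lamT)
      fix s assume s: "s \<in> {0..T}"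
      show "((\<lambda>t. Z t *v v) has_vector_derivative (- transpose (A s) ** Z s) *v v) (at s within {0..T})"
        by (rule bounded_linear.has_vector_derivative[OF bounded_linear_matrix_vector_mult_left
              solves_ivp_Icc[OF Z T(2) s]])
      let ?z = "Z s *v v"
      have "?z \<bullet> ((- transpose (A s) ** Z s) *v v) = - (lam s * (?z \<bullet> (trunc_H \<epsilon> \<Sigma>1 (S s) *v ?z)))"
        unfolding matrix_vector_mul_assoc[symmetric] tA
        by (simp add: A_def scaleR_matrix_vector_assoc[symmetric]
            bounded_bilinear.minus_left[OF bounded_bilinear_matrix_vector_mult])
      also have "\<dots> \<le> lam s * ((1 / real CARD('n)) * (norm ?z)\<^sup>2)"
        using mult_left_mono[OF trunc_H_ge[of ?z "S s"] lam0[OF s]] by simp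
      finally show "?z \<bullet> ((- transpose (A s) ** Z s) *v v) \<le> lam s * (1 / real CARD('n)) * (norm ?z)\<^sup>2"
        by (simp add: mult_ac)
    qed
    also have "integral {0..t} (\<lambda>t. lam t * (1 / real CARD('n))) = integral {0..t} lam * (1 / real CARD('n))"
      by (rule integral_mult_left)
    also have "norm (Z 0 *v v) * exp (integral {0..t} lam * (1 / real CARD('n)))
        \<le> norm v * exp (integral {0..T} lam * (1 / real CARD('n)))"
      using int_mono[OF t] Z by (auto simp: solves_ivp_def intro!: mult_left_mono divide_right_mono)
    finally show ?thesis .
  qed
  have lower: "\<epsilon> \<le> \<theta> \<bullet> (S t *v \<theta>)" if t: "t \<in> {0..T}" and \<theta>: "norm \<theta> = 1" for t \<theta>
  proof -
    \<comment> \<open>\<open>Z t\<close> inverts \<open>transpose (X t)\<close> and sends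
      \<open>v\<close> to the unit vector \<open>\<theta>\<close>, so the upper bound on
      \<open>Z\<close> is a lower bound on \<open>norm v\<close>. Squaring turns the rate 1/n into
      the 2/n of the cutoff.\<close>
    define v where "v = transpose (X t) *v \<theta>"
    have "X t ** transpose (Z t) = mat 1" using ZX[OF t] matrix_left_right_inverse by blast
    then have "transpose (X t ** transpose (Z t)) = mat 1" by simp
    then have "Z t ** transpose (X t) = mat 1" by (simp add: matrix_transpose_mul)
    then have "Z t *v v = \<theta>" unfolding v_def by (simp only: matrix_vector_mul_assoc) simp
    then have "1 \<le> norm v * exp (integral {0..T} lam * (1 / real CARD('n)))"
      using Z_bound[OF t, of v] \<theta> by simp
    then have "exp (- (1 / real CARD('n)) * integral {0..T} lam) \<le> norm v"
      by (simp add: exp_minus field_simps)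
    then have "(exp (- (1 / real CARD('n)) * integral {0..T} lam))\<^sup>2 \<le> (norm v)\<^sup>2"
      by (rule power_mono) simp
    then have "exp (- (2 / real CARD('n)) * integral {0..T} lam) \<le> (norm v)\<^sup>2"
      by (simp add: exp_double[symmetric])
    then have "c * exp (- (2 / real CARD('n)) * integral {0..T} lam) \<le> c * (norm v)\<^sup>2"
      using c(1) by (intro mult_left_mono) auto
    then have "\<epsilon> \<le> v \<bullet> (\<Sigma>0 *v v)" using \<epsilon>_le c(2)[of v] by linarith
    also have "\<dots> = \<theta> \<bullet> (S t *v \<theta>)"
      unfolding SX[OF t] v_def inner_matrix_vector_mult transpose_transpose matrix_vector_mul_assoc
      by (simp add: matrix_mul_assoc)
    finally show ?thesis .
  qed
  have "pos_def (S t) \<and> (S has_vector_derivative covariance_rhs lam \<Sigma>1 t (S t)) (at t within {0..T})"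
    if t: "t \<in> {0..T}" for t
  proof
    have "invertible (X t)" using ZX[OF t] invertible_left_inverse by blast
    then show "pos_def (S t)" unfolding SX[OF t] by (rule pos_def_congruence[OF _ \<Sigma>0])
    show "(S has_vector_derivative covariance_rhs lam \<Sigma>1 t (S t)) (at t within {0..T})"
      using S'[OF t] covariance_rhs_eq_field[OF lower[OF t] normS[OF t]] by simp
  qed
  then show ?thesis using S0 by blast
qed

end

text \<open>On a compact interval both solutions stay in a ball, and their forms stay above positive
  constants on the sphere. One truncation with the smaller constant is invisible to both, and its
  field is Lipschitz.\<close>

lemma covariance_unique_Icc:
  fixes S S' :: "real \<Rightarrow> real^'n^'n"
  assumes \<Sigma>1: "pos_def \<Sigma>1" and lam: "continuous_on {0..T} lam" "\<And>t. t \<in> {0..T} \<Longrightarrow> 0 \<le> lam t"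
    and S: "\<And>t. t \<in> {0..T} \<Longrightarrow> (S has_vector_derivative covariance_rhs lam \<Sigma>1 t (S t)) (at t within {0..T})"
      "\<And>t. t \<in> {0..T} \<Longrightarrow> pos_def (S t)"
    and S': "\<And>t. t \<in> {0..T} \<Longrightarrow> (S' has_vector_derivative covariance_rhs lam \<Sigma>1 t (S' t)) (at t within {0..T})"
      "\<And>t. t \<in> {0..T} \<Longrightarrow> pos_def (S' t)"
    and init: "S 0 = S' 0" and t: "t \<in> {0..T}"
  shows "S t = S' t"
proof -
  have T: "0 \<le> T" using t by simp
  have cont: "continuous_on {0..T} S" "continuous_on {0..T} S'"
    unfolding continuous_on_eq_continuous_within
    by (blast intro: has_vector_derivative_continuous S(1) S'(1))+
  obtain c where c: "0 < c" "\<And>t \<theta>. t \<in> {0..T} \<Longrightarrow> norm \<theta> = 1 \<Longrightarrow> c \<le> \<theta> \<bullet> (S t *v \<theta>)"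
    using pos_def_path_lower_bound[OF T cont(1) S(2)] by blast
  obtain c' where c': "0 < c'" "\<And>t \<theta>. t \<in> {0..T} \<Longrightarrow> norm \<theta> = 1 \<Longrightarrow> c' \<le> \<theta> \<bullet> (S' t *v \<theta>)"
    using pos_def_path_lower_bound[OF T cont(2) S'(2)] by blast
  have "bounded (S ` {0..T} \<union> S' ` {0..T})"
    using cont by (intro compact_imp_bounded compact_Un compact_continuous_image) auto
  then obtain R where "\<forall>x\<in>S ` {0..T} \<union> S' ` {0..T}. norm x \<le> R" unfolding bounded_iff by blast
  then have R: "norm (S t) \<le> R" "norm (S' t) \<le> R" if "t \<in> {0..T}" for t using that by auto
  have R0: "0 \<le> R" using R(1)[OF t] norm_ge_zero order_trans by blast
  interpret truncation "min c c'" \<Sigma>1 using c(1) c'(1) \<Sigma>1 by unfold_locales auto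
  show ?thesis
  proof (rule ode_unique_Icc[where f = "\<lambda>t S. lam t *\<^sub>R field R S" and l = "\<lambda>t. lam t * field_lip R"
        and T = T and x = S and y = S'])
    show "(S has_vector_derivative lam t *\<^sub>R field R (S t)) (at t within {0..T})" if t: "t \<in> {0..T}" for t
      using S(1)[OF t] covariance_rhs_eq_field[of "S t" R lam t] c(2)[OF t] R(1)[OF t]
      by (simp add: min.coboundedI1)
    show "(S' has_vector_derivative lam t *\<^sub>R field R (S' t)) (at t within {0..T})" if t: "t \<in> {0..T}" for t
      using S'(1)[OF t] covariance_rhs_eq_field[of "S' t" R lam t] c'(2)[OF t] R(2)[OF t]
      by (simp add: min.coboundedI2)
    show "continuous_on {0..T} (\<lambda>t. lam t * field_lip R)" by (intro continuous_intros lam)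
  qed (use R0 lam t init in \<open>auto intro: scaled_field_lipschitz\<close>)
qed

lemma solves_covariance_unique:
  assumes "pos_def \<Sigma>1" "continuous_on {0..<1} lam" "\<And>t. t \<in> {0..<1} \<Longrightarrow> 0 \<le> lam t"
    and "solves_covariance lam \<Sigma>1 \<Sigma>0 S" "solves_covariance lam \<Sigma>1 \<Sigma>0 S'" and t: "t \<in> {0..<1}"
  shows "S t = S' t"
proof (rule covariance_unique_Icc[of \<Sigma>1 t lam])
  show "continuous_on {0..t} lam" using assms(2) t by (auto intro: continuous_on_Ico_Icc)
qed (use assms in \<open>auto simp: solves_covariance_def solves_ivp_def intro: solves_ivp_Icc\<close>)

text \<open>The cutoff depends on \<open>T\<close> through the integral of \<open>lam\<close>, so
  each \<open>{0..T}\<close> gets its own solution, with the largest cutoff that the lower bound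
  admits. By uniqueness any two agree on the shorter interval.\<close>

lemma solves_covariance_exists:
  fixes \<Sigma>0 \<Sigma>1 :: "real^'n^'n"
  assumes \<Sigma>0: "pos_def \<Sigma>0" and \<Sigma>1: "pos_def \<Sigma>1"
    and lam: "continuous_on {0..<1} lam" "\<And>t. t \<in> {0..<1} \<Longrightarrow> 0 \<le> lam t"
  shows "\<exists>S. solves_covariance lam \<Sigma>1 \<Sigma>0 S"
proof -
  obtain c where c: "0 < c" "\<And>x. c * (norm x)\<^sup>2 \<le> x \<bullet> (\<Sigma>0 *v x)" using pos_def_lower_bound[OF \<Sigma>0] by blast
  have "\<forall>T\<in>{0..<1}. \<exists>S. S 0 = \<Sigma>0 \<and> (\<forall>t\<in>{0..T}. pos_def (S t) \<and>
    (S has_vector_derivative covariance_rhs lam \<Sigma>1 t (S t)) (at t within {0..T}))"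
  proof
    fix T :: real assume T: "T \<in> {0..<1}"
    interpret truncation "c * exp (- (2 / real CARD('n)) * integral {0..T} lam)" \<Sigma>1
      using c(1) \<Sigma>1 by unfold_locales auto
    show "\<exists>S. S 0 = \<Sigma>0 \<and> (\<forall>t\<in>{0..T}. pos_def (S t) \<and>
      (S has_vector_derivative covariance_rhs lam \<Sigma>1 t (S t)) (at t within {0..T}))"
      using trunc_covariance_solution[OF lam \<Sigma>0 c _ _ order_refl] T by simp
  qed
  from bchoice[OF this] obtain s where s0: "\<And>T. T \<in> {0..<1} \<Longrightarrow> s T 0 = \<Sigma>0"
    and s_pd: "\<And>T t. T \<in> {0..<1} \<Longrightarrow> t \<in> {0..T} \<Longrightarrow> pos_def (s T t)"
    and s_der: "\<And>T t. T \<in> {0..<1} \<Longrightarrow> t \<in> {0..T} \<Longrightarrow>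
      (s T has_vector_derivative covariance_rhs lam \<Sigma>1 t (s T t)) (at t within {0..T})"
    by blast
  have agree: "s T t = s T' t" if T: "t \<in> {0..T}" "T \<le> T'" "T' < 1" for T T' t
  proof (rule covariance_unique_Icc[OF \<Sigma>1 _ _ _ _ _ _ _ T(1)])
    show "continuous_on {0..T} lam" using lam(1) T by (auto intro: continuous_on_Ico_Icc)
    fix u assume u: "u \<in> {0..T}"
    show "(s T' has_vector_derivative covariance_rhs lam \<Sigma>1 u (s T' u)) (at u within {0..T})"
      by (rule has_vector_derivative_within_subset[OF s_der]) (use u T in auto)
  qed (use T lam(2) s0 s_pd s_der in auto)
  \<comment> \<open>Each solution is read at its own right endpoint. Around \<open>t\<close> the
    result equals \<open>s T\<close> for a later \<open>T\<close>, where \<open>t\<close> is no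
    longer the right endpoint and the derivative within \<open>{0..<1}\<close> is available.\<close>
  define S where "S t = s t t" for t
  have "solves_covariance lam \<Sigma>1 \<Sigma>0 S"
    unfolding solves_covariance_def solves_ivp_def
  proof (intro conjI ballI)
    show "S 0 = \<Sigma>0" by (simp add: S_def s0)
    fix t :: real assume t: "t \<in> {0..<1}"
    show "pos_def (S t)" using s_pd t by (simp add: S_def)
    define T where "T = (t + 1) / 2"
    have T: "t < T" "T < 1" "t \<in> {0..T}" "T \<in> {0..<1}" using t by (auto simp: T_def)
    have eq: "S u = s T u" if "u \<in> {0..T}" for u
      unfolding S_def using that T by (intro agree) auto
    have "(S has_vector_derivative covariance_rhs lam \<Sigma>1 t (s T t)) (at t within {0..T})"
      by (rule has_vector_derivative_transform[OF T(3) _ s_der[OF T(4,3)]]) (rule eq)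
    then show "(S has_vector_derivative covariance_rhs lam \<Sigma>1 t (S t)) (at t within {0..<1})"
      using at_within_Icc_eq_Ico[OF T(1,2)] eq[OF T(3)] by simp
  qed
  then show ?thesis by blast
qed

section \<open>The affine flow\<close>

lemma slice_displacement_mv_normal:
  fixes S \<Sigma>1 :: "real^'n^'n"
  assumes S: "pos_def S" and \<Sigma>1: "pos_def \<Sigma>1" and \<theta>: "norm \<theta> = 1"
  shows "slice_displacement (mv_normal m S) (mv_normal m1 \<Sigma>1) x \<theta> =
    outer_square \<theta> *v (x - m1) - (alpha \<Sigma>1 S \<theta> *\<^sub>R outer_square \<theta>) *v (x - m)"
proof -
  have nz: "\<theta> \<noteq> 0" using \<theta> by auto
  have pos: "0 < sqrt (\<theta> \<bullet> (S *v \<theta>))" "0 < sqrt (\<theta> \<bullet> (\<Sigma>1 *v \<theta>))"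
    using S \<Sigma>1 nz unfolding pos_def_def by auto
  have "normal_transport (\<theta> \<bullet> m) (sqrt (\<theta> \<bullet> (S *v \<theta>))) (\<theta> \<bullet> m1) (sqrt (\<theta> \<bullet> (\<Sigma>1 *v \<theta>))) (\<theta> \<bullet> x)
      = \<theta> \<bullet> m1 + alpha \<Sigma>1 S \<theta> * (\<theta> \<bullet> (x - m))"
    by (simp add: normal_transport_def alpha_def real_sqrt_divide inner_diff_right)
  then show ?thesis
    unfolding slice_displacement_def projected_law_mv_normal[OF S nz] projected_law_mv_normal[OF \<Sigma>1 nz]
      monotone_ot_map_normal[OF pos]
    by (simp add: outer_square_mult_vector scaleR_matrix_vector_assoc[symmetric]
        inner_diff_right[of \<theta> x m1] scaleR_diff_left[symmetric] del: scaleR_diff_left)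
qed

lemma sliced_field_mv_normal:
  fixes S \<Sigma>1 :: "real^'n^'n"
  assumes S: "pos_def S" and \<Sigma>1: "pos_def \<Sigma>1"
  shows "integrable sphere_measure (slice_displacement (mv_normal m S) (mv_normal m1 \<Sigma>1) x)"
    and "sliced_field (mv_normal m S) (mv_normal m1 \<Sigma>1) x =
      (1 / real CARD('n)) *\<^sub>R (x - m1) - (H_mat \<Sigma>1 S + (1 / real CARD('n)) *\<^sub>R mat 1) *v (x - m)"
proof -
  obtain c where c: "0 < c" "\<And>x. c * (norm x)\<^sup>2 \<le> x \<bullet> (S *v x)" using pos_def_lower_bound[OF S] by blast
  \<comment> \<open>The form of \<open>S\<close> stays above \<open>c\<close> on the sphere, so
    \<open>alpha\<close> agrees there with the continuous \<open>trunc_alpha\<close>, which yields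
    integrability.\<close>
  interpret truncation c \<Sigma>1 using c(1) \<Sigma>1 by unfold_locales
  have c': "c \<le> \<theta> \<bullet> (S *v \<theta>)" if "norm \<theta> = 1" for \<theta> using c(2)[of \<theta>] that by simp
  have "continuous_on (sphere 0 1) (\<lambda>\<theta>. alpha \<Sigma>1 S \<theta> *\<^sub>R outer_square \<theta>)
      \<longleftrightarrow> continuous_on (sphere 0 1) (\<lambda>\<theta>. trunc_alpha c \<Sigma>1 S \<theta> *\<^sub>R outer_square \<theta>)"
    by (rule continuous_on_cong) (auto simp: alpha_def trunc_alpha_def real_sqrt_divide max_absorb2 c')
  then have G: "integrable sphere_measure (\<lambda>\<theta>. alpha \<Sigma>1 S \<theta> *\<^sub>R outer_square \<theta>)"
    using continuous_on_trunc_integrand integrable_sphere_measure by blast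
  have O: "integrable sphere_measure (outer_square :: real^'n \<Rightarrow> _)"
    by (rule integrable_sphere_measure[OF continuous_on_outer_square])
  note bl = bounded_linear_matrix_vector_mult_left[where 'n = 'n and 'm = 'n]
  have eq: "slice_displacement (mv_normal m S) (mv_normal m1 \<Sigma>1) x \<theta> =
    outer_square \<theta> *v (x - m1) - (alpha \<Sigma>1 S \<theta> *\<^sub>R outer_square \<theta>) *v (x - m)"
    if "\<theta> \<in> space sphere_measure" for \<theta>
    using slice_displacement_mv_normal[OF S \<Sigma>1] that by (simp add: space_sphere_measure)
  have int: "integrable sphere_measure (\<lambda>\<theta>. outer_square \<theta> *v (x - m1) - (alpha \<Sigma>1 S \<theta> *\<^sub>R outer_square \<theta>) *v (x - m))"
    by (intro Bochner_Integration.integrable_diff integrable_bounded_linear[OF bl] G O)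
  then show "integrable sphere_measure (slice_displacement (mv_normal m S) (mv_normal m1 \<Sigma>1) x)"
    by (subst Bochner_Integration.integrable_cong[OF refl eq]) auto
  have "sliced_field (mv_normal m S) (mv_normal m1 \<Sigma>1) x =
      (\<integral>\<theta>. outer_square \<theta> *v (x - m1) - (alpha \<Sigma>1 S \<theta> *\<^sub>R outer_square \<theta>) *v (x - m) \<partial>sphere_measure)"
    unfolding sliced_field_def by (rule Bochner_Integration.integral_cong[OF refl eq])
  also have "\<dots> = (\<integral>\<theta>. outer_square \<theta> \<partial>sphere_measure) *v (x - m1)
      - (\<integral>\<theta>. alpha \<Sigma>1 S \<theta> *\<^sub>R outer_square \<theta> \<partial>sphere_measure) *v (x - m)"
    by (subst Bochner_Integration.integral_diff)
      (intro integrable_bounded_linear[OF bl] G O refl | simp add: integral_bounded_linear[OF bl G] integral_bounded_linear[OF bl O])+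
  also have "\<dots> = (1 / real CARD('n)) *\<^sub>R (x - m1) - (H_mat \<Sigma>1 S + (1 / real CARD('n)) *\<^sub>R mat 1) *v (x - m)"
    by (simp add: integral_outer_square H_mat_def scaleR_matrix_vector_assoc[symmetric])
  finally show "sliced_field (mv_normal m S) (mv_normal m1 \<Sigma>1) x =
      (1 / real CARD('n)) *\<^sub>R (x - m1) - (H_mat \<Sigma>1 S + (1 / real CARD('n)) *\<^sub>R mat 1) *v (x - m)" .
qed

locale covariance_flow =
  fixes m0 m1 :: "real^'n" and \<Sigma>0 \<Sigma>1 :: "real^'n^'n" and lam :: "real \<Rightarrow> real"
    and \<Sigma> :: "real \<Rightarrow> real^'n^'n"
  assumes \<Sigma>0: "pos_def \<Sigma>0" and \<Sigma>1: "pos_def \<Sigma>1"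
    and lam: "continuous_on {0..<1} lam"
    and sol: "solves_covariance lam \<Sigma>1 \<Sigma>0 \<Sigma>"
begin

abbreviation "m \<equiv> mean_path lam m1 m0"
abbreviation "K t \<equiv> K_mat lam \<Sigma>1 t (\<Sigma> t)"
abbreviation "drift \<equiv> \<lambda>t x. K t *v x + eta lam m1 m0 \<Sigma>1 \<Sigma> t"

lemma ivp: "solves_ivp (covariance_rhs lam \<Sigma>1) \<Sigma>0 \<Sigma>"
  and pd: "t \<in> {0..<1} \<Longrightarrow> pos_def (\<Sigma> t)"
  using sol by (auto simp: solves_covariance_def)

text \<open>The terms \<open>x / n\<close> from the two averages cancel, leaving
  \<open>- H x\<close> and a part constant in \<open>x\<close>; multiplication by
  \<open>- lam t\<close> turns the constant part into \<open>eta\<close>.\<close>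

lemma feedback_eq_drift:
  assumes "t \<in> {0..<1}"
  shows "- (lam t *\<^sub>R sliced_field (mv_normal (m t) (\<Sigma> t)) (mv_normal m1 \<Sigma>1) x) = drift t x"
  unfolding sliced_field_mv_normal(2)[OF pd[OF assms] \<Sigma>1] eta_def K_mat_def
  by (simp add: matrix_vector_mult_add_rdistrib matrix_vector_mult_diff_distrib
      scaleR_matrix_vector_assoc[symmetric] algebra_simps)

text \<open>On each \<open>{0..T}\<close> the form stays above a positive constant along the
  solution, so \<open>H_mat\<close> coincides there with the Lipschitz
  \<open>trunc_H\<close>.\<close>

lemma continuous_on_K: "continuous_on {0..<1} K"
proof -
  have "continuous_on {0..<1} (\<lambda>t. H_mat \<Sigma>1 (\<Sigma> t))"
  proof (rule continuous_on_Ico_if_Icc)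
    fix T :: real assume T: "0 \<le> T" "T < 1"
    have S: "continuous_on {0..T} \<Sigma>" using solves_ivp_continuous_on[OF ivp] T(2) by (rule continuous_on_Ico_Icc)
    obtain c where c: "0 < c" "\<And>t \<theta>. t \<in> {0..T} \<Longrightarrow> norm \<theta> = 1 \<Longrightarrow> c \<le> \<theta> \<bullet> (\<Sigma> t *v \<theta>)"
      by (rule pos_def_path_lower_bound[OF T(1) S]) (use pd T in auto)
    interpret truncation c \<Sigma>1 using c(1) \<Sigma>1 by unfold_locales
    have "continuous_on {0..T} (\<lambda>t. trunc_H c \<Sigma>1 (\<Sigma> t))"
      by (rule continuous_on_compose2[OF continuous_on_trunc_H S]) auto
    then show "continuous_on {0..T} (\<lambda>t. H_mat \<Sigma>1 (\<Sigma> t))"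
      by (rule continuous_on_eq) (simp add: H_mat_eq_trunc_H c)
  qed
  then show ?thesis unfolding K_mat_def by (intro continuous_on_scaleR lam)
qed

text \<open>At \<open>x = m t\<close> the terms with \<open>H\<close> from \<open>K\<close> and
  \<open>eta\<close> cancel. What is left is \<open>lam t / n\<close> times \<open>m1 - m t\<close>,
  an equation solved by the exponential formula.\<close>

lemma mean_path_solves: "solves_ivp drift m0 m"
  unfolding solves_ivp_def
proof (intro conjI ballI)
  show "m 0 = m0" by (simp add: mean_path_def)
  fix t :: real assume t: "t \<in> {0..<1}"
  have "((\<lambda>t. integral {0..t} lam) has_field_derivative lam t) (at t within {0..<1})"
    using has_vector_derivative_integral_Ico[OF lam t]
    by (simp add: has_real_derivative_iff_has_vector_derivative)
  then have "((\<lambda>t. exp (- (1 / real CARD('n)) * integral {0..t} lam)) has_field_derivative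
      exp (- (1 / real CARD('n)) * integral {0..t} lam) * (- (1 / real CARD('n)) * lam t)) (at t within {0..<1})"
    by (auto intro!: derivative_eq_intros)
  then have "(m has_vector_derivative
      (exp (- (1 / real CARD('n)) * integral {0..t} lam) * (- (1 / real CARD('n)) * lam t)) *\<^sub>R (m0 - m1))
      (at t within {0..<1})"
    unfolding mean_path_def[abs_def] has_real_derivative_iff_has_vector_derivative
    using has_vector_derivative_add[OF has_vector_derivative_const
        bounded_linear.has_vector_derivative[OF bounded_linear_scaleR_left], of _ _ _ m1 "m0 - m1"]
    by (simp only: add_0_left)
  also have "(exp (- (1 / real CARD('n)) * integral {0..t} lam) * (- (1 / real CARD('n)) * lam t)) *\<^sub>R (m0 - m1)
      = - (lam t / real CARD('n)) *\<^sub>R (m t - m1)"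
    by (simp add: mean_path_def mult.commute)
  also have "\<dots> = drift t (m t)"
    by (simp add: eta_def K_mat_def matrix_vector_mult_add_rdistrib
      scaleR_matrix_vector_assoc[symmetric] algebra_simps)
  finally show "(m has_vector_derivative drift t (m t)) (at t within {0..<1})" .
qed

lemma drift_unique:
  assumes "solves_ivp drift x0 x" "solves_ivp drift x0 y" "t \<in> {0..<1}"
  shows "x t = y t"
proof (rule solves_ivp_unique[OF assms(1,2) _ _ assms(3)])
  show "continuous_on {0..<1} (\<lambda>t. norm (K t))" by (intro continuous_intros continuous_on_K)
  show "norm (drift t u - drift t v) \<le> norm (K t) * norm (u - v)" for t u v
    using norm_matrix_vector_mult_le[of "K t" "u - v"] by (simp add: matrix_vector_mult_diff_distrib)
qed

text \<open>\<open>m\<close> is one trajectory and \<open>X\<close> carries the deviation from it,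
  so a single matrix path serves all initial values. Freezing \<open>K\<close> along
  \<open>\<Sigma>\<close> makes \<open>lyapunov_solution\<close> applicable with this same
  \<open>X\<close>.\<close>

lemma fundamental_matrix:
  "\<exists>X. (\<forall>x0. solves_ivp drift x0 (\<lambda>t. m t + X t *v (x0 - m0))) \<and>
    (\<forall>t\<in>{0..<1}. invertible (X t) \<and> X t ** \<Sigma>0 ** transpose (X t) = \<Sigma> t)"
proof -
  obtain X where X: "solves_ivp (\<lambda>t X. K t ** X) (mat 1) X"
    using fundamental_matrix_exists[OF continuous_on_K] by blast
  have "continuous_on {0..<1} (\<lambda>t. - transpose (K t))"
    by (intro continuous_intros bounded_linear.continuous_on[OF bounded_linear_transpose] continuous_on_K)
  then obtain Z where Z: "solves_ivp (\<lambda>t Z. - transpose (K t) ** Z) (mat 1) Z"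
    using fundamental_matrix_exists by blast
  show ?thesis
  proof (intro exI[of _ X] conjI allI ballI)
    fix x0
    have "((\<lambda>t. m t + X t *v (x0 - m0)) has_vector_derivative drift t (m t) + (K t ** X t) *v (x0 - m0))
        (at t within {0..<1})" if "t \<in> {0..<1}" for t
      using mean_path_solves X that unfolding solves_ivp_def
      by (intro has_vector_derivative_add
          bounded_linear.has_vector_derivative[OF bounded_linear_matrix_vector_mult_left]) auto
    moreover have "drift t (m t) + (K t ** X t) *v (x0 - m0) = drift t (m t + X t *v (x0 - m0))" for t
      by (simp add: matrix_vector_right_distrib matrix_vector_mul_assoc)
    ultimately show "solves_ivp drift x0 (\<lambda>t. m t + X t *v (x0 - m0))"
      using mean_path_solves X by (simp add: solves_ivp_def)
  next
    fix t :: real assume t: "t \<in> {0..<1}"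
    show "invertible (X t)"
      using adjoint_fundamental_matrix[OF X Z t] invertible_left_inverse by blast
    have "\<Sigma> t = X t ** \<Sigma> 0 ** transpose (X t)"
      by (rule lyapunov_solution[OF continuous_on_K X, of t])
        (use t solves_ivp_Icc[OF ivp, of t] in auto)
    then show "X t ** \<Sigma>0 ** transpose (X t) = \<Sigma> t"
      using ivp by (simp add: solves_ivp_def)
  qed
qed

lemma random_solution_exists: "\<exists>X. solves_random_ivp M drift X0 X"
proof -
  obtain X where "\<And>x0. solves_ivp drift x0 (\<lambda>t. m t + X t *v (x0 - m0))"
    using fundamental_matrix by blast
  then show ?thesis
    unfolding solves_random_ivp_def by (intro exI[of _ "\<lambda>t \<omega>. m t + X t *v (X0 \<omega> - m0)"]) auto
qed

lemma random_solution_law: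
  assumes X0: "distributed M lborel X0 (mv_normal_density m0 \<Sigma>0)"
    and Y: "solves_random_ivp M drift X0 Y" and t: "t \<in> {0..<1}"
  shows "distributed M lborel (Y t) (mv_normal_density (m t) (\<Sigma> t))"
proof -
  obtain X where X: "\<And>x0. solves_ivp drift x0 (\<lambda>t. m t + X t *v (x0 - m0))"
    and inv: "invertible (X t)" and XX: "X t ** \<Sigma>0 ** transpose (X t) = \<Sigma> t"
    using fundamental_matrix t by blast
  have [measurable]: "X0 \<in> borel_measurable M" and X0_law: "distr M lborel X0 = mv_normal m0 \<Sigma>0"
    using X0 by (auto simp: distributed_def mv_normal_def)
  have Yeq: "Y t \<omega> = (m t - X t *v m0) + X t *v X0 \<omega>" if "\<omega> \<in> space M" for \<omega>
  proof -
    have "Y t \<omega> = m t + X t *v (X0 \<omega> - m0)"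
      using Y that by (intro drift_unique[OF _ X t]) (simp add: solves_random_ivp_def)
    then show ?thesis by (simp add: matrix_vector_mult_diff_distrib)
  qed
  \<comment> \<open>\<open>solves_random_ivp\<close> speaks of trajectories only; measurability
    comes from the affine formula that pathwise uniqueness provides.\<close>
  then have [measurable]: "Y t \<in> borel_measurable M"
    by (subst measurable_cong[of M _ "\<lambda>\<omega>. (m t - X t *v m0) + X t *v X0 \<omega>"]) auto
  have "distr M lborel (Y t) = distr M borel (\<lambda>\<omega>. (m t - X t *v m0) + X t *v X0 \<omega>)"
    using Yeq by (intro distr_cong) auto
  also have "\<dots> = distr (distr M lborel X0) borel (\<lambda>x. (m t - X t *v m0) + X t *v x)"
    by (subst distr_distr) (auto simp: comp_def)
  also have "\<dots> = mv_normal (m t) (\<Sigma> t)"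
    unfolding X0_law using distr_mv_normal_affine[OF inv \<Sigma>0, of m0 "m t - X t *v m0"] XX by simp
  finally show ?thesis by (simp add: distributed_def mv_normal_def)
qed

end

theorem proposition2:
  fixes m0 m1 :: "real ^ 'n" and \<Sigma>0 \<Sigma>1 :: "real ^ 'n ^ 'n" and lam :: "real \<Rightarrow> real"
  assumes "pos_def \<Sigma>0" and "pos_def \<Sigma>1"
    and "continuous_on {0..<1} lam" and "\<forall>t\<in>{0..<1}. lam t \<ge> 0"
  shows
    "\<exists>\<Sigma>. solves_covariance lam \<Sigma>1 \<Sigma>0 \<Sigma> \<and>
       (\<forall>\<Sigma>'. solves_covariance lam \<Sigma>1 \<Sigma>0 \<Sigma>' \<longrightarrow> (\<forall>t\<in>{0..<1}. \<Sigma>' t = \<Sigma> t)) \<and>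
       (let m = mean_path lam m1 m0;
            \<eta> = eta lam m1 m0 \<Sigma>1 \<Sigma>;
            drift = (\<lambda>t x. K_mat lam \<Sigma>1 t (\<Sigma> t) *v x + \<eta> t);
            \<rho> = (\<lambda>t. mv_normal (m t) (\<Sigma> t));
            \<rho>1 = mv_normal m1 \<Sigma>1;
            feedback = (\<lambda>t x. - (lam t *\<^sub>R sliced_field (\<rho> t) \<rho>1 x))
        in
          (\<forall>(M :: 'w measure) X0.
             prob_space M \<and> distributed M lborel X0 (mv_normal_density m0 \<Sigma>0) \<longrightarrow>
             (\<exists>X. solves_random_ivp M drift X0 X \<and>
                (\<forall>Y. solves_random_ivp M drift X0 Y \<longrightarrow>
                   (\<forall>t\<in>{0..<1}. \<forall>\<omega>\<in>space M. Y t \<omega> = X t \<omega>)) \<and>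
                (\<forall>t\<in>{0..<1}. distributed M lborel (X t) (mv_normal_density (m t) (\<Sigma> t))))) \<and>
          (\<forall>t\<in>{0..<1}. \<forall>x.
             integrable sphere_measure (slice_displacement (\<rho> t) \<rho>1 x) \<and>
             feedback t x = drift t x) \<and>
          (\<forall>t\<in>{0..<1}. \<exists>A b. \<forall>x. feedback t x = A *v x + b) \<and>
          (\<forall>(M :: 'w measure) X0 X.
             prob_space M \<and> distributed M lborel X0 (mv_normal_density m0 \<Sigma>0) \<and>
             solves_random_ivp M feedback X0 X \<longrightarrow>
             (\<forall>t\<in>{0..<1}. \<exists>\<mu> C. pos_def C \<and>
                distributed M lborel (X t) (mv_normal_density \<mu> C))))"
proof -
  have lam_nonneg: "\<And>t. t \<in> {0..<1} \<Longrightarrow> 0 \<le> lam t" using assms(4) by blast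
  obtain \<Sigma> where \<Sigma>: "solves_covariance lam \<Sigma>1 \<Sigma>0 \<Sigma>"
    using solves_covariance_exists[OF assms(1-3) lam_nonneg] by blast
  interpret covariance_flow m0 m1 \<Sigma>0 \<Sigma>1 lam \<Sigma>
    using assms(1-3) \<Sigma> by unfold_locales
  let ?feedback = "\<lambda>t x. - (lam t *\<^sub>R sliced_field (mv_normal (m t) (\<Sigma> t)) (mv_normal m1 \<Sigma>1) x)"
  have "\<forall>\<Sigma>'. solves_covariance lam \<Sigma>1 \<Sigma>0 \<Sigma>' \<longrightarrow> (\<forall>t\<in>{0..<1}. \<Sigma>' t = \<Sigma> t)"
    using solves_covariance_unique[OF assms(2,3) lam_nonneg _ \<Sigma>] by blast
  moreover have "\<exists>X. solves_random_ivp M drift X0 X \<and>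
        (\<forall>Y. solves_random_ivp M drift X0 Y \<longrightarrow> (\<forall>t\<in>{0..<1}. \<forall>\<omega>\<in>space M. Y t \<omega> = X t \<omega>)) \<and>
        (\<forall>t\<in>{0..<1}. distributed M lborel (X t) (mv_normal_density (m t) (\<Sigma> t)))"
    if "distributed M lborel X0 (mv_normal_density m0 \<Sigma>0)" for M :: "'w measure" and X0
  proof -
    obtain X where X: "solves_random_ivp M drift X0 X" using random_solution_exists by blast
    have "Y t \<omega> = X t \<omega>" if "solves_random_ivp M drift X0 Y" "t \<in> {0..<1}" "\<omega> \<in> space M" for Y t \<omega>
      using drift_unique[of "X0 \<omega>" "\<lambda>t. Y t \<omega>" "\<lambda>t. X t \<omega>"] X that by (simp add: solves_random_ivp_def)
    then show ?thesis using X random_solution_law[OF that X] by blast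
  qed
  moreover have "integrable sphere_measure (slice_displacement (mv_normal (m t) (\<Sigma> t)) (mv_normal m1 \<Sigma>1) x)
      \<and> ?feedback t x = drift t x" if "t \<in> {0..<1}" for t x
    using sliced_field_mv_normal(1)[OF pd[OF that] \<Sigma>1] feedback_eq_drift[OF that] by simp
  moreover have "\<exists>A b. \<forall>x. ?feedback t x = A *v x + b" if "t \<in> {0..<1}" for t
    using feedback_eq_drift[OF that] by blast
  moreover have "\<exists>\<mu> C. pos_def C \<and> distributed M lborel (X t) (mv_normal_density \<mu> C)"
    if X0: "distributed M lborel X0 (mv_normal_density m0 \<Sigma>0)"
      and X: "solves_random_ivp M ?feedback X0 X" and t: "t \<in> {0..<1}"
    for M :: "'w measure" and X0 X t
  proof -
    \<comment> \<open>\<open>solves_ivp\<close> evaluates the field only at times in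
      \<open>{0..<1}\<close>, where feedback and drift coincide.\<close>
    have "solves_random_ivp M drift X0 X"
      using X feedback_eq_drift by (simp add: solves_random_ivp_def solves_ivp_def)
    then show ?thesis using random_solution_law[OF X0 _ t] pd[OF t] by blast
  qed
  ultimately show ?thesis
    unfolding Let_def using \<Sigma> by (intro exI[of _ \<Sigma>] conjI) blast+
qed

end
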